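(* Let $p$ be a fixed prime. For a positive integer $n$, the number of isomorphism classes of nilpotent rings of order $p^{n}$ is $p^{\alpha}$, where $\alpha=\alpha(n)$ satisfies \[ \alpha = \frac{4}{27}n^{3} + O(n^{5/2}). \]
   Context: Rings are associative but are not assumed to have a multiplicative identity (nor to be commutative). A ring $R$ is nilpotent if $R^m=0$ for some $m\ge 1$, i.e. all products of $m$ elements of $R$ vanish. The prime $p$ is fixed and $n$ varies; $g(n)=O(h(n))$ means $|g(n)|\le C\,h(n)$ for all $n\ge 1$ for some constant $C$ not depending on $n$ ($C$ may depend on $p$). *)

theory Defs
  imports Complex_Main "HOL-Computational_Algebra.Primes" "HOL-Algebra.Coset" "HOL-Algebra.Ring"
begin

text \<open>
  The locale \<^locale>\<open>ring\<close> of HOL-Algebra requires a multiplicative identity, so rings that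
  need not have one are introduced here, over the same record type.  The field \<^const>\<open>one\<close> of
  the record is unconstrained and is never used; isomorphisms ignore it as well, so it does not
  influence any isomorphism class.  (The additive group only refers to \<^const>\<open>zero\<close>.)
\<close>

locale rng = abelian_group R for R (structure) +
  assumes m_closed: "\<lbrakk>x \<in> carrier R; y \<in> carrier R\<rbrakk> \<Longrightarrow> x \<otimes> y \<in> carrier R"
    and m_assoc: "\<lbrakk>x \<in> carrier R; y \<in> carrier R; z \<in> carrier R\<rbrakk>
           \<Longrightarrow> (x \<otimes> y) \<otimes> z = x \<otimes> (y \<otimes> z)"
    and l_distr: "\<lbrakk>x \<in> carrier R; y \<in> carrier R; z \<in> carrier R\<rbrakk>
           \<Longrightarrow> (x \<oplus> y) \<otimes> z = x \<otimes> z \<oplus> y \<otimes> z"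
    and r_distr: "\<lbrakk>x \<in> carrier R; y \<in> carrier R; z \<in> carrier R\<rbrakk>
           \<Longrightarrow> z \<otimes> (x \<oplus> y) = z \<otimes> x \<oplus> z \<otimes> y"

text \<open>
  Without an identity there is no empty product, so a product of \<open>m \<ge> 1\<close> elements
  \<open>x\<^sub>1, \<dots>, x\<^sub>m\<close> is the left-nested product \<open>foldl (\<otimes>) x\<^sub>1 [x\<^sub>2, \<dots>, x\<^sub>m]\<close>.
\<close>

definition nilpotent_rng :: "('a, 'm) ring_scheme \<Rightarrow> bool" where
  "nilpotent_rng R \<longleftrightarrow> rng R \<and>
     (\<exists>m\<ge>1. \<forall>x xs. set (x # xs) \<subseteq> carrier R \<and> length (x # xs) = m
        \<longrightarrow> foldl (\<otimes>\<^bsub>R\<^esub>) x xs = \<zero>\<^bsub>R\<^esub>)"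

definition rng_iso :: "('a, 'm) ring_scheme \<Rightarrow> ('b, 'n) ring_scheme \<Rightarrow> ('a \<Rightarrow> 'b) set" where
  "rng_iso R S =
     {h. bij_betw h (carrier R) (carrier S) \<and>
         (\<forall>x\<in>carrier R. \<forall>y\<in>carrier R.
            h (x \<oplus>\<^bsub>R\<^esub> y) = h x \<oplus>\<^bsub>S\<^esub> h y \<and> h (x \<otimes>\<^bsub>R\<^esub> y) = h x \<otimes>\<^bsub>S\<^esub> h y)}"

text \<open>
  Isomorphism classes of nilpotent rings of order \<open>k\<close>.  Letting the carriers range over the
  finite subsets of \<^typ>\<open>nat\<close> loses nothing for \<open>k > 0\<close>:
  see \<open>nilpotent_rng_copy_on_nat\<close> below.
\<close>

definition nilpotent_rngs :: "nat \<Rightarrow> nat ring set" where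
  "nilpotent_rngs k = {R. nilpotent_rng R \<and> order R = k}"

definition rng_iso_rel :: "nat \<Rightarrow> (nat ring \<times> nat ring) set" where
  "rng_iso_rel k =
     {(R, S). R \<in> nilpotent_rngs k \<and> S \<in> nilpotent_rngs k \<and> rng_iso R S \<noteq> {}}"

definition nilpotent_rng_classes :: "nat \<Rightarrow> nat ring set set" where
  "nilpotent_rng_classes k = nilpotent_rngs k // rng_iso_rel k"


lemma rng_iso_id: "id \<in> rng_iso R R"
  by (simp add: rng_iso_def)

lemma rng_iso_sym:
  assumes "rng R" and h: "h \<in> rng_iso R S"
  shows "inv_into (carrier R) h \<in> rng_iso S R"
proof -
  interpret rng R by fact
  let ?g = "inv_into (carrier R) h"
  have bij: "bij_betw h (carrier R) (carrier S)"
    using h by (simp add: rng_iso_def)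
  have "?g (x \<oplus>\<^bsub>S\<^esub> y) = ?g x \<oplus>\<^bsub>R\<^esub> ?g y \<and> ?g (x \<otimes>\<^bsub>S\<^esub> y) = ?g x \<otimes>\<^bsub>R\<^esub> ?g y"
    if "x \<in> carrier S" "y \<in> carrier S" for x y
  proof -
    have "x \<in> h ` carrier R" "y \<in> h ` carrier R"
      using that by (simp_all add: bij_betw_imp_surj_on[OF bij])
    then obtain a b where ab: "a \<in> carrier R" "b \<in> carrier R" "x = h a" "y = h b"
      by (elim imageE) (rule that)
    then have "x \<oplus>\<^bsub>S\<^esub> y = h (a \<oplus>\<^bsub>R\<^esub> b)" "x \<otimes>\<^bsub>S\<^esub> y = h (a \<otimes>\<^bsub>R\<^esub> b)"
      using h by (simp_all add: rng_iso_def)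
    then show ?thesis
      using ab bij by (simp add: bij_betw_inv_into_left m_closed)
  qed
  then show ?thesis
    using bij_betw_inv_into[OF bij] by (simp add: rng_iso_def)
qed

lemma rng_iso_trans:
  assumes h: "h \<in> rng_iso R S" and g: "g \<in> rng_iso S T"
  shows "g \<circ> h \<in> rng_iso R T"
proof -
  have "h x \<in> carrier S" if "x \<in> carrier R" for x
    using h that by (auto simp: rng_iso_def bij_betw_def)
  then show ?thesis
    using h g by (auto simp: rng_iso_def intro: bij_betw_trans)
qed

lemma equiv_rng_iso_rel: "equiv (nilpotent_rngs k) (rng_iso_rel k)"
proof (rule equivI)
  show "rng_iso_rel k \<subseteq> nilpotent_rngs k \<times> nilpotent_rngs k"
    by (auto simp: rng_iso_rel_def)
  show "refl_on (nilpotent_rngs k) (rng_iso_rel k)"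
    using rng_iso_id by (force simp: refl_on_def rng_iso_rel_def)
  show "sym (rng_iso_rel k)"
  proof (rule symI)
    fix R S assume *: "(R, S) \<in> rng_iso_rel k"
    then obtain h where "h \<in> rng_iso R S" "rng R"
      by (auto simp: rng_iso_rel_def nilpotent_rngs_def nilpotent_rng_def)
    from rng_iso_sym[OF this(2,1)] * show "(S, R) \<in> rng_iso_rel k"
      by (auto simp: rng_iso_rel_def)
  qed
  show "trans (rng_iso_rel k)"
  proof (rule transI)
    fix R S T assume *: "(R, S) \<in> rng_iso_rel k" "(S, T) \<in> rng_iso_rel k"
    then obtain h g where "h \<in> rng_iso R S" "g \<in> rng_iso S T"
      by (auto simp: rng_iso_rel_def)
    from rng_iso_trans[OF this] * show "(R, T) \<in> rng_iso_rel k"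
      by (auto simp: rng_iso_rel_def)
  qed
qed

lemma rng_transfer:
  assumes "rng R" and h: "h \<in> rng_iso R S" and z: "\<zero>\<^bsub>S\<^esub> = h \<zero>\<^bsub>R\<^esub>"
  shows "rng S"
proof -
  interpret rng R by fact
  have im: "carrier S = h ` carrier R"
    using h by (auto simp: rng_iso_def bij_betw_def)
  have add: "h x \<oplus>\<^bsub>S\<^esub> h y = h (x \<oplus>\<^bsub>R\<^esub> y)"
    and mul: "h x \<otimes>\<^bsub>S\<^esub> h y = h (x \<otimes>\<^bsub>R\<^esub> y)"
    if "x \<in> carrier R" "y \<in> carrier R" for x y
    using h that by (auto simp: rng_iso_def)
  have "abelian_group S"
  proof (rule abelian_groupI)
    fix x assume "x \<in> carrier S"
    then obtain a where a: "a \<in> carrier R" "x = h a" by (auto simp: im)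
    then have "h (\<ominus>\<^bsub>R\<^esub> a) \<oplus>\<^bsub>S\<^esub> x = \<zero>\<^bsub>S\<^esub>"
      by (simp add: add z l_neg)
    then show "\<exists>y\<in>carrier S. y \<oplus>\<^bsub>S\<^esub> x = \<zero>\<^bsub>S\<^esub>"
      using a by (auto simp: im)
  qed (auto simp: im z add a_ac)
  then show ?thesis
    by (intro rng.intro rng_axioms.intro)
      (auto simp: im add mul m_closed m_assoc l_distr r_distr)
qed

lemma nilpotent_rng_transfer:
  assumes R: "nilpotent_rng R" and h: "h \<in> rng_iso R S" and z: "\<zero>\<^bsub>S\<^esub> = h \<zero>\<^bsub>R\<^esub>"
  shows "nilpotent_rng S"
proof -
  interpret rng R using R by (simp add: nilpotent_rng_def)
  have im: "carrier S = h ` carrier R"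
    using h by (auto simp: rng_iso_def bij_betw_def)
  have fold: "foldl (\<otimes>\<^bsub>S\<^esub>) (h x) (map h xs) = h (foldl (\<otimes>\<^bsub>R\<^esub>) x xs)"
    if "x \<in> carrier R" "set xs \<subseteq> carrier R" for x xs
    using that
  proof (induction xs arbitrary: x)
    case (Cons y ys)
    have "h x \<otimes>\<^bsub>S\<^esub> h y = h (x \<otimes>\<^bsub>R\<^esub> y)"
      using Cons.prems h by (simp add: rng_iso_def)
    then show ?case
      using Cons.IH[of "x \<otimes>\<^bsub>R\<^esub> y"] Cons.prems by (simp add: m_closed)
  qed simp
  obtain m where m: "m \<ge> 1" "\<And>x xs. set (x # xs) \<subseteq> carrier R \<Longrightarrow> length (x # xs) = m
      \<Longrightarrow> foldl (\<otimes>\<^bsub>R\<^esub>) x xs = \<zero>\<^bsub>R\<^esub>"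
    using R unfolding nilpotent_rng_def by blast
  have "foldl (\<otimes>\<^bsub>S\<^esub>) y ys = \<zero>\<^bsub>S\<^esub>"
    if ys: "set (y # ys) \<subseteq> carrier S" "length (y # ys) = m" for y ys
  proof -
    define g where "g = inv_into (carrier R) h"
    have g: "g u \<in> carrier R" "h (g u) = u" if "u \<in> carrier S" for u
      using that by (auto simp: im g_def f_inv_into_f inv_into_into)
    have "map h (map g ys) = ys"
      using ys(1) by (auto simp: g(2) subset_iff intro: map_idI)
    moreover have "set (g y # map g ys) \<subseteq> carrier R"
      using ys(1) g(1) by auto
    ultimately show ?thesis
      using fold[of "g y" "map g ys"] m(2)[of "g y" "map g ys"] ys g(2)[of y] z by simp
  qed
  then show ?thesis
    using m(1) rng_transfer[OF rng_axioms h z] unfolding nilpotent_rng_def by blast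
qed

lemma nilpotent_rng_copy_on_nat:
  fixes R :: "('a, 'm) ring_scheme"
  assumes R: "nilpotent_rng R" and ord: "order R = k" "k > 0"
  shows "\<exists>S\<in>nilpotent_rngs k. rng_iso R S \<noteq> {}"
proof -
  interpret rng R using R by (simp add: nilpotent_rng_def)
  have "finite (carrier R)"
    using ord by (simp add: order_def card_ge_0_finite)
  then obtain h where h: "bij_betw h (carrier R) {0..<k}"
    using ex_bij_betw_finite_nat ord by (metis order_def)
  define g where "g = inv_into (carrier R) h"
  have gh: "g (h x) = x" if "x \<in> carrier R" for x
    using h that by (simp add: g_def bij_betw_inv_into_left)
  define S :: "nat ring" where
    "S = \<lparr>carrier = {0..<k}, monoid.mult = (\<lambda>x y. h (g x \<otimes>\<^bsub>R\<^esub> g y)), one = 0,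
          zero = h \<zero>\<^bsub>R\<^esub>, add = (\<lambda>x y. h (g x \<oplus>\<^bsub>R\<^esub> g y))\<rparr>"
  have "h \<in> rng_iso R S"
    using h by (simp add: rng_iso_def S_def gh)
  moreover from this have "nilpotent_rng S"
    by (rule nilpotent_rng_transfer[OF R]) (simp add: S_def)
  moreover have "order S = k"
    by (simp add: order_def S_def)
  ultimately show ?thesis
    by (auto simp: nilpotent_rngs_def)
qed

end

theory Submission
  imports Defs "HOL-Algebra.Multiplicative_Group"
begin

text \<open>
  Lower bound: a bilinear map \<open>F\<^sub>p\<^sup>r \<times> F\<^sub>p\<^sup>r \<rightarrow> F\<^sub>p\<^sup>n\<^sup>-\<^sup>r\<close> with \<open>r\<close> about \<open>2n/3\<close> defines a ring structure on
  \<open>F\<^sub>p\<^sup>n\<close> in which all triple products vanish.  There are \<open>p\<close> to the power \<open>r\<^sup>2 (n - r)\<close> such maps, and at most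
  \<open>p\<close> to the power \<open>n\<^sup>2\<close> of them lie in one isomorphism class, since an additive map is determined by its values
  on the unit vectors.

  Upper bound: let \<open>s\<close> be \<open>\<surd>n\<close> rounded up.  A greedy choice gives at most \<open>s\<close> elements \<open>y\<close> such that the
  additive group \<open>J\<close> generated by the \<open>R y\<close> has index at most \<open>p\<^sup>s\<close> in \<open>J + R x\<close> for every \<open>x\<close>.  Let
  \<open>|J| = p\<^sup>e\<close> and let \<open>n - e\<close> elements \<open>c\<close> generate \<open>R\<close> modulo \<open>J\<close>.  Because \<open>R\<close> is nilpotent, its
  multiplication is determined by left and right multiplication by the \<open>y\<close> and by the products of the \<open>c\<close>.
  Each of these \<open>(n - e)\<^sup>2\<close> products lies in \<open>J + R c\<close> and so costs \<open>e + s\<close> digits to the base \<open>p\<close>; everything else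
  costs \<open>O(n\<^sup>2 s)\<close> digits.  Finally \<open>(n - e)\<^sup>2 e \<le> 4n\<^sup>3/27\<close>.
\<close>

section \<open>Integer combinations in abelian groups\<close>

text \<open>Coefficients are integers and not residues, since the additive group can be any abelian
  \<open>p\<close>-group. They form a total function on \<open>nat\<close>, so one \<open>v\<close>
  serves every initial segment of a basis.\<close>

primrec lincomb :: "('a, 'm) ring_scheme \<Rightarrow> (nat \<Rightarrow> 'a) \<Rightarrow> (nat \<Rightarrow> int) \<Rightarrow> nat \<Rightarrow> 'a" where
  "lincomb R a v 0 = \<zero>\<^bsub>R\<^esub>"
| "lincomb R a v (Suc k) = lincomb R a v k \<oplus>\<^bsub>R\<^esub> [v k] \<cdot>\<^bsub>R\<^esub> a k"

lemma lincomb_cong: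
  assumes "\<And>i. i < k \<Longrightarrow> a i = b i" "\<And>i. i < k \<Longrightarrow> v i = w i"
  shows "lincomb R a v k = lincomb R b w k"
  using assms by (induction k) auto

context abelian_group
begin

lemma lincomb_closed [simp, intro]:
  assumes "\<And>i. i < k \<Longrightarrow> a i \<in> carrier G"
  shows "lincomb G a v k \<in> carrier G"
  using assms by (induction k) auto

lemma smult_add:
  assumes "x \<in> carrier G"
  shows "[(z + w :: int)] \<cdot> x = [z] \<cdot> x \<oplus> [w] \<cdot> x"
  using add.int_pow_mult[of x z w] assms by (simp add: add_pow_def)

lemma smult_smult:
  assumes "x \<in> carrier G"
  shows "[(z :: int)] \<cdot> ([(w :: int)] \<cdot> x) = [(w * z)] \<cdot> x"
  using add.int_pow_pow[of x z w] assms by (simp add: add_pow_def)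

lemma smult_distrib:
  assumes "x \<in> carrier G" "y \<in> carrier G"
  shows "[(z :: int)] \<cdot> (x \<oplus> y) = [z] \<cdot> x \<oplus> [z] \<cdot> y"
  using add.int_pow_distrib[of x y z] assms by (simp add: add_pow_def)

lemma smult_uminus:
  assumes "x \<in> carrier G"
  shows "[(- z :: int)] \<cdot> x = \<ominus> ([z] \<cdot> x)"
  using add.int_pow_neg[of x z] assms by (simp add: add_pow_def)

lemma smult_one [simp]: "x \<in> carrier G \<Longrightarrow> [(1 :: int)] \<cdot> x = x"
  using add.int_pow_1 by (simp add: add_pow_def)

lemma smult_zero [simp]: "[(0 :: int)] \<cdot> x = \<zero>"
  by (simp add: add_pow_def)

lemma lincomb_add:
  assumes "\<And>i. i < k \<Longrightarrow> a i \<in> carrier G"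
  shows "lincomb G a (\<lambda>i. v i + w i) k = lincomb G a v k \<oplus> lincomb G a w k"
  using assms by (induction k) (auto simp: smult_add a_ac)

lemma lincomb_smult:
  assumes "\<And>i. i < k \<Longrightarrow> a i \<in> carrier G"
  shows "lincomb G a (\<lambda>i. z * v i) k = [z] \<cdot> lincomb G a v k"
  using assms by (induction k) (auto simp: smult_distrib smult_smult mult.commute)

lemma lincomb_diff:
  assumes "\<And>i. i < k \<Longrightarrow> a i \<in> carrier G"
  shows "lincomb G a (\<lambda>i. v i - w i) k = lincomb G a v k \<ominus> lincomb G a w k"
proof -
  have "lincomb G a (\<lambda>i. v i + (-1) * w i) k = lincomb G a v k \<oplus> [(- 1 :: int)] \<cdot> lincomb G a w k"
    using assms lincomb_smult[of k a "-1" w] by (subst lincomb_add) auto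
  then show ?thesis
    using assms by (simp add: smult_uminus a_minus_def)
qed

lemma additive_subgroupI_minus:
  assumes "H \<subseteq> carrier G" "\<zero> \<in> H" "\<And>x y. x \<in> H \<Longrightarrow> y \<in> H \<Longrightarrow> x \<ominus> y \<in> H"
  shows "additive_subgroup H G"
proof -
  have uminus: "\<ominus> x \<in> H" if "x \<in> H" for x
    using assms(3)[OF assms(2) that] that assms(1) by (auto simp: a_minus_def)
  have "x \<oplus> y \<in> H" if "x \<in> H" "y \<in> H" for x y
  proof -
    have "\<ominus> (\<ominus> y) = y" using that assms(1) by auto
    then show ?thesis
      using assms(3)[OF that(1) uminus[OF that(2)]] by (simp add: a_minus_def)
  qed
  then show ?thesis
    using assms uminus by (intro additive_subgroupI add.subgroupI) (auto simp: a_inv_def)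
qed

lemma additive_subgroup_smult:
  assumes "additive_subgroup H G" "x \<in> H"
  shows "[(z :: int)] \<cdot> x \<in> H"
  using add.subgroup_int_pow_closed[OF additive_subgroup.a_subgroup[OF assms(1)] assms(2), of z]
  by (simp add: add_pow_def)

lemma additive_subgroup_lincomb:
  assumes "additive_subgroup H G" "\<And>i. i < k \<Longrightarrow> a i \<in> H"
  shows "lincomb G a v k \<in> H"
  using assms(2)
proof (induction k)
  case 0
  then show ?case using assms(1) by (simp add: additive_subgroup.zero_closed)
next
  case (Suc k)
  then show ?case
    using assms(1) by (simp add: additive_subgroup.a_closed additive_subgroup_smult)
qed

lemma additive_subgroup_minus:
  assumes "additive_subgroup H G" "x \<in> H" "y \<in> H"
  shows "x \<ominus> y \<in> H"
  using assms by (simp add: a_minus_def additive_subgroup.a_closed additive_subgroup.a_inv_closed)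

section \<open>Adjoining an element of order \<open>p\<close> modulo a subgroup\<close>

lemma multiple_in_subgroup_dvd:
  assumes H: "additive_subgroup H G" and p: "prime p" and a: "a \<in> carrier G" "a \<notin> H" "[int p] \<cdot> a \<in> H"
    and z: "[z] \<cdot> a \<in> H"
  shows "int p dvd z"
proof (rule ccontr)
  assume "\<not> int p dvd z"
  then have "coprime (int p) z"
    using p by (simp add: prime_imp_coprime)
  then obtain u w where uw: "u * int p + w * z = 1"
    using bezout_int[of "int p" z] by (auto simp: coprime_iff_gcd_eq_1)
  have "a = [u] \<cdot> ([int p] \<cdot> a) \<oplus> [w] \<cdot> ([z] \<cdot> a)"
    using a(1) uw by (simp add: smult_smult mult.commute flip: smult_add)
  also have "\<dots> \<in> H"
    using H a(3) z by (simp add: additive_subgroup.a_closed additive_subgroup_smult)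
  finally show False using a(2) by simp
qed

text \<open>Cauchy's theorem modulo \<open>H\<close>: if \<open>k\<close> is least with
  \<open>p^k x\<close> in \<open>H\<close>, then \<open>p^(k-1) x\<close> has order \<open>p\<close>
  modulo \<open>H\<close>.\<close>

lemma exists_prime_step:
  assumes H: "additive_subgroup H G" and K: "additive_subgroup K G" and x: "x \<in> K" "x \<notin> H"
    and tors: "[int (p ^ N)] \<cdot> x \<in> H"
  shows "\<exists>a\<in>K. a \<notin> H \<and> [int p] \<cdot> a \<in> H"
proof -
  define k where "k = (LEAST k. [int (p ^ k)] \<cdot> x \<in> H)"
  have k: "[int (p ^ k)] \<cdot> x \<in> H"
    unfolding k_def using tors by (rule LeastI)
  have xc: "x \<in> carrier G" using K x additive_subgroup.a_subset by blast
  have "k \<noteq> 0" using k x xc by (metis of_nat_1 power_0 smult_one)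
  then obtain j where j: "k = Suc j" by (cases k) auto
  have "[int (p ^ j)] \<cdot> x \<notin> H"
    using not_less_Least[of j "\<lambda>k. [int (p ^ k)] \<cdot> x \<in> H"] j by (simp add: k_def)
  moreover have "[int p] \<cdot> ([int (p ^ j)] \<cdot> x) \<in> H"
    using k xc by (simp add: smult_smult j mult.commute)
  ultimately show ?thesis
    using additive_subgroup_smult[OF K x(1)] by blast
qed

text \<open>\<open>H'\<close> is the group generated by \<open>H\<close> and \<open>a\<close>. As
  \<open>p a\<close> lies in \<open>H\<close>, digits below \<open>p\<close> suffice as coefficients
  of \<open>a\<close>, and \<open>multiple_in_subgroup_dvd\<close> makes them unique; hence the
  factor \<open>p\<close>.\<close>

lemma prime_extension:
  assumes H: "additive_subgroup H G" and p: "prime p" and a: "a \<in> carrier G" "a \<notin> H" "[int p] \<cdot> a \<in> H"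
    and fin: "finite H"
  defines "H' \<equiv> (\<lambda>(h, v). h \<oplus> [v] \<cdot> a) ` (H \<times> {0..<int p})"
  shows "additive_subgroup H' G" "card H' = p * card H"
proof -
  have Hc: "h \<in> carrier G" if "h \<in> H" for h
    using that H additive_subgroup.a_subset by blast
  have H'I: "h \<oplus> [z] \<cdot> a \<in> H'" if "h \<in> H" for h and z :: int
  proof -
    have "h \<oplus> [z] \<cdot> a = h \<oplus> [(int p * (z div int p) + z mod int p)] \<cdot> a" by simp
    also have "\<dots> = (h \<oplus> [(z div int p)] \<cdot> ([int p] \<cdot> a)) \<oplus> [(z mod int p)] \<cdot> a"
      using a that Hc by (simp only: smult_add smult_smult) (simp add: a_assoc)
    finally show ?thesis
      using H a that p prime_gt_0_nat[OF p]
      by (auto simp: H'_def additive_subgroup.a_closed additive_subgroup_smult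
          intro!: image_eqI[of _ _ "(h \<oplus> [(z div int p)] \<cdot> ([int p] \<cdot> a), z mod int p)"])
  qed
  have diff: "(h \<oplus> [z] \<cdot> a) \<ominus> (h' \<oplus> [z'] \<cdot> a) = (h \<ominus> h') \<oplus> [(z - z')] \<cdot> a"
    if "h \<in> H" "h' \<in> H" for h h' and z z' :: int
    using that Hc a by (simp add: smult_add[of _ z "-z'", simplified] smult_uminus a_minus_def minus_add a_ac)
  show "additive_subgroup H' G"
  proof (rule additive_subgroupI_minus)
    show "H' \<subseteq> carrier G" using Hc a by (auto simp: H'_def)
    show "\<zero> \<in> H'" using H'I[OF additive_subgroup.zero_closed[OF H], of 0] by simp
    fix x y assume "x \<in> H'" "y \<in> H'"
    then obtain h h' and z z' :: int where "x = h \<oplus> [z] \<cdot> a" "y = h' \<oplus> [z'] \<cdot> a" "h \<in> H" "h' \<in> H"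
      by (auto simp: H'_def)
    then show "x \<ominus> y \<in> H'"
      using diff H'I[OF additive_subgroup_minus[OF H]] by simp
  qed
  have "inj_on (\<lambda>(h, v). h \<oplus> [v] \<cdot> a) (H \<times> {0..<int p})"
  proof (rule inj_onI, clarsimp)
    fix h h' and v v' :: int
    assume *: "h \<in> H" "h' \<in> H" "0 \<le> v" "v < int p" "0 \<le> v'" "v' < int p" "h \<oplus> [v] \<cdot> a = h' \<oplus> [v'] \<cdot> a"
    have "(h \<ominus> h') \<oplus> [(v - v')] \<cdot> a = \<zero>"
      using diff[of h h' v v'] * Hc a by (simp add: r_neg a_minus_def)
    then have "[(v - v')] \<cdot> a = \<ominus> (h \<ominus> h')"
      using * Hc a by (metis add.inv_equality add.m_comm add.int_pow_closed minus_closed minus_equality add_pow_def)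
    then have "[(v - v')] \<cdot> a \<in> H"
      using * additive_subgroup_minus[OF H] additive_subgroup.a_inv_closed[OF H] by auto
    then have "int p dvd v - v'" by (rule multiple_in_subgroup_dvd[OF H p a])
    then have "v = v'" using * dvd_imp_le_int[of "v - v'" "int p"] by fastforce
    then show "h = h' \<and> v = v'" using * Hc a by auto
  qed
  then show "card H' = p * card H"
    unfolding H'_def by (subst card_image) (auto simp: card_cartesian_product)
qed

end

section \<open>Bases of abelian p-groups adapted to a composition series\<close>

definition digit_funs :: "nat \<Rightarrow> (nat \<Rightarrow> int) set" where
  "digit_funs p = {v. \<forall>i. 0 \<le> v i \<and> v i < int p}"

lemma (in abelian_group) minus_eq_zero_iff:
  assumes "x \<in> carrier G" "y \<in> carrier G"
  shows "x \<ominus> y = \<zero> \<longleftrightarrow> x = y"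
  using assms by (metis a_minus_def add.inv_closed add.inv_equality add.r_inv minus_minus)

text \<open>Climb from \<open>H\<close> to \<open>K\<close> in \<open>m\<close> steps of index
  \<open>p\<close>; \<open>a i\<close> is the element adjoined at step \<open>i\<close>. Working
  relative to \<open>H\<close> covers bases (\<open>H\<close> zero) and generators modulo a subgroup
  at once.\<close>

lemma (in abelian_group) prime_power_chain:
  assumes H: "additive_subgroup H G" and K: "additive_subgroup K G" and HK: "H \<subseteq> K"
    and fin: "finite K" and p: "prime p" and cardK: "card K = p ^ m * card H"
    and tors: "\<And>x. x \<in> K \<Longrightarrow> [int (p ^ N)] \<cdot> x \<in> H"
  shows "\<exists>a. (\<forall>i<m. a i \<in> K) \<and>
           (\<forall>x\<in>K. \<exists>h\<in>H. \<exists>v\<in>digit_funs p. x = h \<oplus> lincomb G a v m) \<and>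
           (\<forall>i<m. \<exists>h\<in>H. \<exists>v\<in>digit_funs p. [int p] \<cdot> a i = h \<oplus> lincomb G a v i) \<and>
           (\<forall>i<m. \<forall>h\<in>H. \<forall>v. h \<oplus> lincomb G a v (Suc i) = \<zero> \<longrightarrow> int p dvd v i)"
proof -
  have Kc: "K \<subseteq> carrier G" using K by (rule additive_subgroup.a_subset)
  have finH: "finite H" using fin HK finite_subset by blast
  have H0: "\<zero> \<in> H" using H by (rule additive_subgroup.zero_closed)
  then have cardH: "card H > 0" using finH by (auto simp: card_gt_0_iff)
  have zero_digit: "(\<lambda>_. 0) \<in> digit_funs p"
    using prime_gt_0_nat[OF p] by (simp add: digit_funs_def)
  have "\<exists>L a. additive_subgroup L G \<and> H \<subseteq> L \<and> L \<subseteq> K \<and> card L = p ^ j * card H \<and>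
           (\<forall>i<j. a i \<in> L) \<and>
           (\<forall>x\<in>L. \<exists>h\<in>H. \<exists>v\<in>digit_funs p. x = h \<oplus> lincomb G a v j) \<and>
           (\<forall>i<j. \<exists>h\<in>H. \<exists>v\<in>digit_funs p. [int p] \<cdot> a i = h \<oplus> lincomb G a v i) \<and>
           (\<forall>i<j. \<forall>h\<in>H. \<forall>v. h \<oplus> lincomb G a v (Suc i) = \<zero> \<longrightarrow> int p dvd v i)"
    if "j \<le> m" for j
    using that
  proof (induction j)
    case 0
    have "\<exists>h\<in>H. \<exists>v\<in>digit_funs p. x = h \<oplus> \<zero>" if "x \<in> H" for x
      using that zero_digit HK Kc by (intro bexI[of _ x] bexI[OF _ zero_digit]) auto
    then show ?case using H HK by (intro exI[of _ H]) auto
  next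
    case (Suc j)
    then obtain L a where L: "additive_subgroup L G" "H \<subseteq> L" "L \<subseteq> K" "card L = p ^ j * card H"
      and aL: "\<And>i. i < j \<Longrightarrow> a i \<in> L"
      and span: "\<And>x. x \<in> L \<Longrightarrow> \<exists>h\<in>H. \<exists>v\<in>digit_funs p. x = h \<oplus> lincomb G a v j"
      and pa: "\<And>i. i < j \<Longrightarrow> \<exists>h\<in>H. \<exists>v\<in>digit_funs p. [int p] \<cdot> a i = h \<oplus> lincomb G a v i"
      and gap: "\<And>i h v. i < j \<Longrightarrow> h \<in> H \<Longrightarrow> h \<oplus> lincomb G a v (Suc i) = \<zero> \<Longrightarrow> int p dvd v i"
      by (metis Suc_leD)
    \<comment> \<open>As \<open>j < m\<close>, the subgroup \<open>L\<close> reached so far is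
      proper, so a further element can be adjoined.\<close>
    have "card L < card K"
      using L(4) cardK cardH Suc.prems prime_gt_1_nat[OF p] by simp
    then obtain x where "x \<in> K" "x \<notin> L"
      using L(3) by (metis less_irrefl subset_antisym subsetI)
    then obtain b where b: "b \<in> K" "b \<notin> L" "[int p] \<cdot> b \<in> L"
      using exists_prime_step[OF L(1) K, of x p N] tors L(2) by blast
    define L' where "L' = (\<lambda>(h, v). h \<oplus> [v] \<cdot> b) ` (L \<times> {0..<int p})"
    define a' where "a' = a(j := b)"
    have bc: "b \<in> carrier G" and Lc: "L \<subseteq> carrier G" using b Kc L by auto
    have finL: "finite L" using L(3) fin finite_subset by blast
    have L': "additive_subgroup L' G" "card L' = p * card L"
      using prime_extension[OF L(1) p bc b(2,3) finL] by (simp_all add: L'_def)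
    \<comment> \<open>Only index \<open>j\<close> changes, so combinations of the first
      \<open>j\<close> elements, and with them the earlier relations, survive.\<close>
    have a'_lincomb: "lincomb G a' v i = lincomb G a v i" if "i \<le> j" for i v
      using that by (intro lincomb_cong) (auto simp: a'_def)
    have LL': "L \<subseteq> L'"
      using prime_gt_0_nat[OF p] Lc
      by (force simp: L'_def intro!: image_eqI[of _ _ "(_, 0)"])
    have bL': "b \<in> L'"
      using prime_gt_1_nat[OF p] bc additive_subgroup.zero_closed[OF L(1)]
      by (auto simp: L'_def intro!: image_eqI[of _ _ "(\<zero>, 1)"])
    have L'K: "L' \<subseteq> K"
      using b(1) L(3) K by (auto simp: L'_def additive_subgroup.a_closed additive_subgroup_smult)
    have span': "\<exists>h\<in>H. \<exists>v\<in>digit_funs p. x = h \<oplus> lincomb G a' v (Suc j)" if "x \<in> L'" for x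
    proof -
      from that obtain l and z :: int where lz: "l \<in> L" "0 \<le> z" "z < int p" "x = l \<oplus> [z] \<cdot> b"
        by (auto simp: L'_def)
      obtain h v where hv: "h \<in> H" "v \<in> digit_funs p" "l = h \<oplus> lincomb G a v j"
        using span[OF lz(1)] by blast
      have "lincomb G a' (v(j := z)) j = lincomb G a v j"
        by (rule lincomb_cong) (auto simp: a'_def)
      moreover have "lincomb G a v j \<in> carrier G" using aL Lc by auto
      ultimately have "x = h \<oplus> lincomb G a' (v(j := z)) (Suc j)"
        using hv lz bc HK Kc by (auto simp: a'_def a_assoc)
      moreover have "v(j := z) \<in> digit_funs p"
        using hv lz by (auto simp: digit_funs_def)
      ultimately show ?thesis using hv(1) by blast
    qed
    have pa': "\<exists>h\<in>H. \<exists>v\<in>digit_funs p. [int p] \<cdot> a' i = h \<oplus> lincomb G a' v i" if "i < Suc j" for i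
    proof (cases "i = j")
      case True
      then show ?thesis using span[OF b(3)] a'_lincomb[of j] by (simp add: a'_def)
    next
      case False
      then show ?thesis using pa[of i] that a'_lincomb[of i] by (simp add: a'_def)
    qed
    have gap': "int p dvd v i"
      if "i < Suc j" "h \<in> H" "h \<oplus> lincomb G a' v (Suc i) = \<zero>" for i h v
    proof (cases "i = j")
      case True
      have lL: "h \<oplus> lincomb G a v j \<in> L"
        using that L aL additive_subgroup_lincomb[OF L(1)] by (auto intro: additive_subgroup.a_closed)
      have lc: "lincomb G a v j \<in> carrier G" using aL Lc by auto
      have "(h \<oplus> lincomb G a v j) \<oplus> [v j] \<cdot> b = \<zero>"
        using that(3) that(2) HK Kc lc bc a'_lincomb[of j v] True
        by (subst a_assoc) (auto simp: a'_def)
      then have "[v j] \<cdot> b = \<ominus> (h \<oplus> lincomb G a v j)"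
        using lL Lc bc by (metis add.int_pow_closed add.m_comm add_pow_def minus_equality subsetD)
      then have "[v j] \<cdot> b \<in> L"
        using additive_subgroup.a_inv_closed[OF L(1) lL] by simp
      then show ?thesis using multiple_in_subgroup_dvd[OF L(1) p bc b(2,3)] True by simp
    next
      case False
      then show ?thesis using gap[of i h v] that a'_lincomb[of "Suc i" v] by simp
    qed
    have "\<forall>i<Suc j. a' i \<in> L'"
      using aL LL' bL' by (auto simp: a'_def less_Suc_eq)
    then show ?case
      using L' L LL' L'K span' pa' gap'
      by (intro exI[of _ L'] exI[of _ a']) (auto simp: mult.assoc)
  qed
  from this[of m] obtain L a where L: "L \<subseteq> K" "card L = p ^ m * card H"
      "\<forall>i<m. a i \<in> L"
      "\<forall>x\<in>L. \<exists>h\<in>H. \<exists>v\<in>digit_funs p. x = h \<oplus> lincomb G a v m"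
      "\<forall>i<m. \<exists>h\<in>H. \<exists>v\<in>digit_funs p. [int p] \<cdot> a i = h \<oplus> lincomb G a v i"
      "\<forall>i<m. \<forall>h\<in>H. \<forall>v. h \<oplus> lincomb G a v (Suc i) = \<zero> \<longrightarrow> int p dvd v i"
    by (metis le_refl)
  have "L = K" using card_subset_eq[OF fin L(1)] L(2) cardK by simp
  then show ?thesis using L by blast
qed

section \<open>Additive maps, and groups determined by the relations of a basis\<close>

lemma additive_map_zero:
  assumes "abelian_group R" "abelian_group S"
    and "\<And>x. x \<in> carrier R \<Longrightarrow> \<phi> x \<in> carrier S"
    and "\<And>x y. x \<in> carrier R \<Longrightarrow> y \<in> carrier R \<Longrightarrow> \<phi> (x \<oplus>\<^bsub>R\<^esub> y) = \<phi> x \<oplus>\<^bsub>S\<^esub> \<phi> y"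
  shows "\<phi> \<zero>\<^bsub>R\<^esub> = \<zero>\<^bsub>S\<^esub>"
proof -
  interpret R: abelian_group R by fact
  interpret S: abelian_group S by fact
  have "\<phi> \<zero>\<^bsub>R\<^esub> \<oplus>\<^bsub>S\<^esub> \<phi> \<zero>\<^bsub>R\<^esub> = \<phi> \<zero>\<^bsub>R\<^esub>"
    using assms(4)[of "\<zero>\<^bsub>R\<^esub>" "\<zero>\<^bsub>R\<^esub>"] by simp
  then show ?thesis using assms(3) by (simp add: S.add.r_cancel_one')
qed

lemma additive_map_smult:
  assumes "abelian_group R" "abelian_group S"
    and "\<And>x. x \<in> carrier R \<Longrightarrow> \<phi> x \<in> carrier S"
    and "\<And>x y. x \<in> carrier R \<Longrightarrow> y \<in> carrier R \<Longrightarrow> \<phi> (x \<oplus>\<^bsub>R\<^esub> y) = \<phi> x \<oplus>\<^bsub>S\<^esub> \<phi> y"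
    and "x \<in> carrier R"
  shows "\<phi> ([(z :: int)] \<cdot>\<^bsub>R\<^esub> x) = [z] \<cdot>\<^bsub>S\<^esub> \<phi> x"
proof -
  have "\<phi> \<in> hom (add_monoid R) (add_monoid S)"
    using assms by (auto simp: hom_def)
  then show ?thesis
    using hom_int_pow[of \<phi> "add_monoid R" "add_monoid S" x z] assms
    by (simp add: add_pow_def abelian_group.a_group)
qed

lemma additive_map_lincomb:
  assumes "abelian_group R" "abelian_group S"
    and "\<And>x. x \<in> carrier R \<Longrightarrow> \<phi> x \<in> carrier S"
    and "\<And>x y. x \<in> carrier R \<Longrightarrow> y \<in> carrier R \<Longrightarrow> \<phi> (x \<oplus>\<^bsub>R\<^esub> y) = \<phi> x \<oplus>\<^bsub>S\<^esub> \<phi> y"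
    and "\<And>i. i < k \<Longrightarrow> a i \<in> carrier R"
  shows "\<phi> (lincomb R a v k) = lincomb S (\<lambda>i. \<phi> (a i)) v k"
proof -
  interpret R: abelian_group R by fact
  show ?thesis
    using assms(5)
  proof (induction k)
    case 0
    then show ?case using additive_map_zero[of R S \<phi>] assms(1-4) by simp
  next
    case (Suc k)
    then show ?case
      using additive_map_smult[of R S \<phi>] assms(1-4) R.lincomb_closed[of k a] by simp
  qed
qed

text \<open>
  The last condition says that \<open>a i\<close> has order exactly \<open>p\<close> modulo the span of its predecessors; together
  with the matrix \<open>M\<close> of the relations it pins down all integer relations between the \<open>a i\<close>.
\<close>

definition pbasis :: "nat \<Rightarrow> ('a, 'm) ring_scheme \<Rightarrow> nat \<Rightarrow> (nat \<Rightarrow> nat \<Rightarrow> int) \<Rightarrow> (nat \<Rightarrow> 'a) \<Rightarrow> bool" where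
  "pbasis p R n M a \<longleftrightarrow>
     (\<forall>i<n. a i \<in> carrier R) \<and>
     (\<forall>x\<in>carrier R. \<exists>v\<in>digit_funs p. x = lincomb R a v n) \<and>
     (\<forall>i<n. [int p] \<cdot>\<^bsub>R\<^esub> a i = lincomb R a (M i) i) \<and>
     (\<forall>i<n. \<forall>v. lincomb R a v (Suc i) = \<zero>\<^bsub>R\<^esub> \<longrightarrow> int p dvd v i)"

text \<open>Induction on \<open>k\<close>: the last coefficient is divisible by \<open>p\<close>, so
  a row of \<open>M\<close> trades the last basis element for its predecessors and leaves a shorter
  relation. The rewriting depends only on \<open>v\<close> and \<open>M\<close>, hence runs
  identically for \<open>b\<close>.\<close>

lemma pbasis_relations:
  assumes "abelian_group R" "abelian_group S" and a: "pbasis p R n M a" and b: "pbasis p S n M b"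
    and "k \<le> n" "lincomb R a v k = \<zero>\<^bsub>R\<^esub>"
  shows "lincomb S b v k = \<zero>\<^bsub>S\<^esub>"
proof -
  interpret R: abelian_group R by fact
  interpret S: abelian_group S by fact
  show ?thesis
    using assms(5,6)
  proof (induction k arbitrary: v)
    case (Suc k)
    have ac: "a i \<in> carrier R" "b i \<in> carrier S" if "i \<le> k" for i
      using a b that Suc.prems(1) by (auto simp: pbasis_def)
    have "int p dvd v k"
      using a Suc.prems by (auto simp: pbasis_def)
    then obtain q where q: "v k = int p * q" by auto
    have R: "lincomb R a v (Suc k) = lincomb R a (\<lambda>i. v i + q * M k i) k"
      using ac a Suc.prems(1) R.smult_smult[of "a k" q "int p"] q
      by (simp add: R.lincomb_add R.lincomb_smult pbasis_def)
    have S: "lincomb S b v (Suc k) = lincomb S b (\<lambda>i. v i + q * M k i) k"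
      using ac b Suc.prems(1) S.smult_smult[of "b k" q "int p"] q
      by (simp add: S.lincomb_add S.lincomb_smult pbasis_def)
    show ?case
      using Suc.IH[of "\<lambda>i. v i + q * M k i"] Suc.prems R S by simp
  qed simp
qed

text \<open>\<open>pbasis_relations\<close> in both directions shows that \<open>a\<close> and
  \<open>b\<close> satisfy the same integer relations, so transporting coefficients is well defined
  and injective.\<close>

lemma pbasis_isomorphism:
  assumes "abelian_group R" "abelian_group S" and a: "pbasis p R n M a" and b: "pbasis p S n M b"
  shows "\<exists>\<phi>. bij_betw \<phi> (carrier R) (carrier S) \<and>
           (\<forall>x\<in>carrier R. \<forall>y\<in>carrier R. \<phi> (x \<oplus>\<^bsub>R\<^esub> y) = \<phi> x \<oplus>\<^bsub>S\<^esub> \<phi> y) \<and>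
           (\<forall>v. \<phi> (lincomb R a v n) = lincomb S b v n)"
proof -
  interpret R: abelian_group R by fact
  interpret S: abelian_group S by fact
  have ac: "a i \<in> carrier R" "b i \<in> carrier S" if "i < n" for i
    using a b that by (auto simp: pbasis_def)
  have lc: "lincomb R a v n \<in> carrier R" "lincomb S b v n \<in> carrier S" for v
    using ac by auto
  have eq: "lincomb R a v n = lincomb R a w n \<longleftrightarrow> lincomb S b v n = lincomb S b w n" for v w
  proof -
    have "lincomb R a v n = lincomb R a w n \<longleftrightarrow> lincomb R a (\<lambda>i. v i - w i) n = \<zero>\<^bsub>R\<^esub>"
      using lc ac by (subst R.lincomb_diff) (auto simp: R.minus_eq_zero_iff)
    also have "\<dots> \<longleftrightarrow> lincomb S b (\<lambda>i. v i - w i) n = \<zero>\<^bsub>S\<^esub>"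
      using pbasis_relations[OF assms(1,2) a b] pbasis_relations[OF assms(2,1) b a] by blast
    also have "\<dots> \<longleftrightarrow> lincomb S b v n = lincomb S b w n"
      using lc ac by (subst S.lincomb_diff) (auto simp: S.minus_eq_zero_iff)
    finally show ?thesis .
  qed
  \<comment> \<open>Which coefficients \<open>SOME\<close> picks does not matter, by
    \<open>eq\<close>.\<close>
  define \<phi> where "\<phi> x = lincomb S b (SOME v. x = lincomb R a v n) n" for x
  have \<phi>: "\<phi> (lincomb R a v n) = lincomb S b v n" for v
  proof -
    have "lincomb R a v n = lincomb R a (SOME w. lincomb R a v n = lincomb R a w n) n"
      by (rule someI[of _ v]) simp
    then show ?thesis unfolding \<phi>_def using eq by metis
  qed
  have spanR: "\<exists>v. x = lincomb R a v n" if "x \<in> carrier R" for x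
    using a that by (auto simp: pbasis_def)
  have spanS: "\<exists>v. x = lincomb S b v n" if "x \<in> carrier S" for x
    using b that by (auto simp: pbasis_def)
  have "inj_on \<phi> (carrier R)"
  proof (rule inj_onI)
    fix x y assume "x \<in> carrier R" "y \<in> carrier R" "\<phi> x = \<phi> y"
    then show "x = y" using spanR[of x] spanR[of y] by (auto simp: \<phi> eq)
  qed
  moreover have "\<phi> ` carrier R = carrier S"
  proof (intro subset_antisym subsetI)
    fix y assume "y \<in> \<phi> ` carrier R"
    then show "y \<in> carrier S" using spanR lc by (auto simp: \<phi>_def)
  next
    fix y assume "y \<in> carrier S"
    then show "y \<in> \<phi> ` carrier R" using spanS[of y] lc by (auto simp flip: \<phi>)
  qed
  moreover have "\<phi> (x \<oplus>\<^bsub>R\<^esub> y) = \<phi> x \<oplus>\<^bsub>S\<^esub> \<phi> y" if xy: "x \<in> carrier R" "y \<in> carrier R" for x y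
  proof -
    obtain v w where vw: "x = lincomb R a v n" "y = lincomb R a w n"
      using spanR xy by blast
    have "x \<oplus>\<^bsub>R\<^esub> y = lincomb R a (\<lambda>i. v i + w i) n"
      unfolding vw using ac by (intro R.lincomb_add[symmetric]) auto
    then have "\<phi> (x \<oplus>\<^bsub>R\<^esub> y) = lincomb S b (\<lambda>i. v i + w i) n" by (simp add: \<phi>)
    also have "\<dots> = \<phi> x \<oplus>\<^bsub>S\<^esub> \<phi> y"
      unfolding vw \<phi> using ac by (intro S.lincomb_add) auto
    finally show ?thesis .
  qed
  ultimately show ?thesis using \<phi> by (auto simp: bij_betw_def intro!: exI[of _ \<phi>])
qed

section \<open>Reconstructing a nilpotent multiplication\<close>

lemma (in abelian_group) minus_minus_swap:
  assumes "a \<in> carrier G" "b \<in> carrier G" "c \<in> carrier G" "d \<in> carrier G"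
  shows "(a \<ominus> b) \<ominus> (c \<ominus> d) = (a \<ominus> c) \<ominus> (b \<ominus> d)"
  using assms by (simp add: a_minus_def minus_add a_ac)

context rng
begin

lemma mult_minus_distrib_left:
  assumes "x \<in> carrier R" "y \<in> carrier R" "z \<in> carrier R"
  shows "z \<otimes> (x \<ominus> y) = z \<otimes> x \<ominus> z \<otimes> y"
proof -
  have "z \<otimes> (x \<ominus> y) \<oplus> z \<otimes> y = z \<otimes> x"
    using assms r_distr[of "x \<ominus> y" y z] by (simp add: a_minus_def a_assoc l_neg)
  then have "z \<otimes> x \<ominus> z \<otimes> y = (z \<otimes> (x \<ominus> y) \<oplus> z \<otimes> y) \<ominus> z \<otimes> y" by simp
  also have "\<dots> = z \<otimes> (x \<ominus> y)"
    using assms by (simp add: a_minus_def a_assoc r_neg m_closed)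
  finally show ?thesis by simp
qed

lemma mult_minus_distrib_right:
  assumes "x \<in> carrier R" "y \<in> carrier R" "z \<in> carrier R"
  shows "(x \<ominus> y) \<otimes> z = x \<otimes> z \<ominus> y \<otimes> z"
proof -
  have "(x \<ominus> y) \<otimes> z \<oplus> y \<otimes> z = x \<otimes> z"
    using assms l_distr[of "x \<ominus> y" y z] by (simp add: a_minus_def a_assoc l_neg)
  then have "x \<otimes> z \<ominus> y \<otimes> z = ((x \<ominus> y) \<otimes> z \<oplus> y \<otimes> z) \<ominus> y \<otimes> z" by simp
  also have "\<dots> = (x \<ominus> y) \<otimes> z"
    using assms by (simp add: a_minus_def a_assoc r_neg m_closed)
  finally show ?thesis by simp
qed

lemma l_null: "x \<in> carrier R \<Longrightarrow> \<zero> \<otimes> x = \<zero>"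
  using additive_map_zero[of R R "\<lambda>y. y \<otimes> x"] abelian_group_axioms m_closed l_distr by simp

lemma r_null: "x \<in> carrier R \<Longrightarrow> x \<otimes> \<zero> = \<zero>"
  using additive_map_zero[of R R "\<lambda>y. x \<otimes> y"] abelian_group_axioms m_closed r_distr by simp

lemma foldl_mult_closed:
  "x \<in> carrier R \<Longrightarrow> set xs \<subseteq> carrier R \<Longrightarrow> foldl (\<otimes>) x xs \<in> carrier R"
  by (induction xs arbitrary: x) (auto simp: m_closed)

lemma mult_foldl_mult:
  "y \<in> carrier R \<Longrightarrow> x \<in> carrier R \<Longrightarrow> set xs \<subseteq> carrier R
    \<Longrightarrow> y \<otimes> foldl (\<otimes>) x xs = foldl (\<otimes>) y (x # xs)"
  by (induction xs arbitrary: x) (auto simp: m_closed simp flip: m_assoc)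

lemma foldl_mult_zero: "set xs \<subseteq> carrier R \<Longrightarrow> foldl (\<otimes>) \<zero> xs = \<zero>"
  by (induction xs) (auto simp: l_null)

lemma foldl_mult_diff:
  "x \<in> carrier R \<Longrightarrow> y \<in> carrier R \<Longrightarrow> set xs \<subseteq> carrier R
    \<Longrightarrow> foldl (\<otimes>) (x \<ominus> y) xs = foldl (\<otimes>) x xs \<ominus> foldl (\<otimes>) y xs"
  by (induction xs arbitrary: x y) (auto simp: m_closed mult_minus_distrib_right)

end

text \<open>\<open>N\<close> is one less than the exponent \<open>m\<close> of
  \<open>nilpotent_rng_def\<close>, because the head \<open>x\<close> is not counted in
  \<open>length xs\<close>.\<close>

lemma nilpotent_rngD:
  assumes "nilpotent_rng R"
  obtains N where "\<And>x xs. x \<in> carrier R \<Longrightarrow> set xs \<subseteq> carrier R \<Longrightarrow> length xs = N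
     \<Longrightarrow> foldl (\<otimes>\<^bsub>R\<^esub>) x xs = \<zero>\<^bsub>R\<^esub>"
proof -
  obtain m where m: "m \<ge> 1" "\<And>x xs. set (x # xs) \<subseteq> carrier R \<Longrightarrow> length (x # xs) = m
      \<Longrightarrow> foldl (\<otimes>\<^bsub>R\<^esub>) x xs = \<zero>\<^bsub>R\<^esub>"
    using assms unfolding nilpotent_rng_def by blast
  show ?thesis using that[of "m - 1"] m by simp
qed

text \<open>
  The defect \<open>D x y = \<phi> (x y) - \<phi> x \<phi> y\<close> satisfies \<open>D x (z y) = D x z \<cdot> \<phi> y\<close> and \<open>D (z y) x = D z (y x)\<close> for
  \<open>y \<in> Y\<close>.  As \<open>C\<close> and \<open>R Y\<close> generate \<open>R\<close>, first \<open>D c x\<close> for \<open>c \<in> C\<close> and then every \<open>D x y\<close> is a sum of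
  defects multiplied by, respectively evaluated at, products of arbitrarily many elements.
\<close>

lemma multiplicative_by_nilpotency:
  assumes R: "nilpotent_rng R" and S: "nilpotent_rng S"
    and closed: "\<And>x. x \<in> carrier R \<Longrightarrow> \<phi> x \<in> carrier S"
    and add: "\<And>x y. x \<in> carrier R \<Longrightarrow> y \<in> carrier R \<Longrightarrow> \<phi> (x \<oplus>\<^bsub>R\<^esub> y) = \<phi> x \<oplus>\<^bsub>S\<^esub> \<phi> y"
    and C: "C \<subseteq> carrier R" and Y: "Y \<subseteq> carrier R"
    and gen: "\<And>H. additive_subgroup H R \<Longrightarrow> C \<subseteq> H \<Longrightarrow> (\<And>z y. z \<in> carrier R \<Longrightarrow> y \<in> Y \<Longrightarrow> z \<otimes>\<^bsub>R\<^esub> y \<in> H)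
                \<Longrightarrow> H = carrier R"
    and multY: "\<And>w y. w \<in> carrier R \<Longrightarrow> y \<in> Y \<Longrightarrow> \<phi> (w \<otimes>\<^bsub>R\<^esub> y) = \<phi> w \<otimes>\<^bsub>S\<^esub> \<phi> y"
      "\<And>w y. w \<in> carrier R \<Longrightarrow> y \<in> Y \<Longrightarrow> \<phi> (y \<otimes>\<^bsub>R\<^esub> w) = \<phi> y \<otimes>\<^bsub>S\<^esub> \<phi> w"
    and multC: "\<And>c d. c \<in> C \<Longrightarrow> d \<in> C \<Longrightarrow> \<phi> (c \<otimes>\<^bsub>R\<^esub> d) = \<phi> c \<otimes>\<^bsub>S\<^esub> \<phi> d"
    and xy: "x \<in> carrier R" "y \<in> carrier R"
  shows "\<phi> (x \<otimes>\<^bsub>R\<^esub> y) = \<phi> x \<otimes>\<^bsub>S\<^esub> \<phi> y"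
proof -
  interpret R: rng R using R by (simp add: nilpotent_rng_def)
  interpret S: rng S using S by (simp add: nilpotent_rng_def)
  define D where "D x y = \<phi> (x \<otimes>\<^bsub>R\<^esub> y) \<ominus>\<^bsub>S\<^esub> \<phi> x \<otimes>\<^bsub>S\<^esub> \<phi> y" for x y
  have zero: "\<phi> \<zero>\<^bsub>R\<^esub> = \<zero>\<^bsub>S\<^esub>"
    by (rule additive_map_zero[OF R.abelian_group_axioms S.abelian_group_axioms closed add])
  have minus: "\<phi> (x \<ominus>\<^bsub>R\<^esub> y) = \<phi> x \<ominus>\<^bsub>S\<^esub> \<phi> y" if "x \<in> carrier R" "y \<in> carrier R" for x y
  proof -
    have "\<phi> (x \<ominus>\<^bsub>R\<^esub> y) \<oplus>\<^bsub>S\<^esub> \<phi> y = \<phi> x"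
      using that add[of "x \<ominus>\<^bsub>R\<^esub> y" y] by (simp add: a_minus_def R.a_assoc R.l_neg)
    then show ?thesis
      using that closed R.minus_closed[OF that] S.r_neg
      by (metis S.add.inv_closed S.a_assoc S.r_zero a_minus_def)
  qed
  have DS: "D x y \<in> carrier S" if "x \<in> carrier R" "y \<in> carrier R" for x y
    using that by (simp add: D_def closed R.m_closed S.m_closed)
  have D0: "D x y = \<zero>\<^bsub>S\<^esub> \<longleftrightarrow> \<phi> (x \<otimes>\<^bsub>R\<^esub> y) = \<phi> x \<otimes>\<^bsub>S\<^esub> \<phi> y"
    if "x \<in> carrier R" "y \<in> carrier R" for x y
    using that by (simp add: D_def closed R.m_closed S.m_closed S.minus_eq_zero_iff)
  have D_r: "D x (y \<ominus>\<^bsub>R\<^esub> z) = D x y \<ominus>\<^bsub>S\<^esub> D x z"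
    if "x \<in> carrier R" "y \<in> carrier R" "z \<in> carrier R" for x y z
    using that
    by (simp add: D_def minus R.mult_minus_distrib_left S.mult_minus_distrib_left closed R.m_closed S.m_closed
        S.minus_minus_swap)
  have D_l: "D (x \<ominus>\<^bsub>R\<^esub> y) z = D x z \<ominus>\<^bsub>S\<^esub> D y z"
    if "x \<in> carrier R" "y \<in> carrier R" "z \<in> carrier R" for x y z
    using that
    by (simp add: D_def minus R.mult_minus_distrib_right S.mult_minus_distrib_right closed R.m_closed S.m_closed
        S.minus_minus_swap)
  have D_zero_r: "D x \<zero>\<^bsub>R\<^esub> = \<zero>\<^bsub>S\<^esub>" if "x \<in> carrier R" for x
    using that by (simp add: D0 zero R.r_null S.r_null closed)
  have D_zero_l: "D \<zero>\<^bsub>R\<^esub> x = \<zero>\<^bsub>S\<^esub>" if "x \<in> carrier R" for x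
    using that by (simp add: D0 zero R.l_null S.l_null closed)
  have D_mult_r: "D x (z \<otimes>\<^bsub>R\<^esub> y) = D x z \<otimes>\<^bsub>S\<^esub> \<phi> y"
    if "x \<in> carrier R" "z \<in> carrier R" "y \<in> Y" for x y z
  proof -
    have y: "y \<in> carrier R" using that Y by auto
    have "\<phi> (x \<otimes>\<^bsub>R\<^esub> (z \<otimes>\<^bsub>R\<^esub> y)) = \<phi> (x \<otimes>\<^bsub>R\<^esub> z) \<otimes>\<^bsub>S\<^esub> \<phi> y"
      using that y multY(1)[of "x \<otimes>\<^bsub>R\<^esub> z" y] by (simp add: R.m_closed R.m_assoc)
    moreover have "\<phi> x \<otimes>\<^bsub>S\<^esub> \<phi> (z \<otimes>\<^bsub>R\<^esub> y) = \<phi> x \<otimes>\<^bsub>S\<^esub> \<phi> z \<otimes>\<^bsub>S\<^esub> \<phi> y"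
      using that y multY(1)[of z y] by (simp add: closed S.m_assoc)
    ultimately show ?thesis
      using that y by (simp add: D_def S.mult_minus_distrib_right closed R.m_closed S.m_closed)
  qed
  have D_mult_l: "D (z \<otimes>\<^bsub>R\<^esub> y) x = D z (y \<otimes>\<^bsub>R\<^esub> x)"
    if "x \<in> carrier R" "z \<in> carrier R" "y \<in> Y" for x y z
  proof -
    have y: "y \<in> carrier R" using that Y by auto
    have "\<phi> (z \<otimes>\<^bsub>R\<^esub> y) \<otimes>\<^bsub>S\<^esub> \<phi> x = \<phi> z \<otimes>\<^bsub>S\<^esub> \<phi> (y \<otimes>\<^bsub>R\<^esub> x)"
      using that y multY by (simp add: closed S.m_assoc)
    then show ?thesis using that y by (simp add: D_def R.m_assoc)
  qed
  obtain N where N: "\<And>x xs. x \<in> carrier S \<Longrightarrow> set xs \<subseteq> carrier S \<Longrightarrow> length xs = N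
     \<Longrightarrow> foldl (\<otimes>\<^bsub>S\<^esub>) x xs = \<zero>\<^bsub>S\<^esub>"
    using nilpotent_rngD[OF S] by blast
  have D_C: "D c x = \<zero>\<^bsub>S\<^esub>" if c: "c \<in> C" and x: "x \<in> carrier R" for c x
  proof -
    have cR: "c \<in> carrier R" using c C by auto
    \<comment> \<open>The induction shortens the tail \<open>xs\<close>: with \<open>N\<close>
      further factors the product vanishes by nilpotency of \<open>S\<close>, and
      \<open>k = N\<close> is the empty tail, that is, \<open>D c x\<close> itself is zero.\<close>
    have "\<forall>x\<in>carrier R. \<forall>xs. set xs \<subseteq> carrier S \<longrightarrow> length xs = N - k \<longrightarrow>
            foldl (\<otimes>\<^bsub>S\<^esub>) (D c x) xs = \<zero>\<^bsub>S\<^esub>" if "k \<le> N" for k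
      using that
    proof (induction k)
      case 0
      then show ?case using N DS cR by simp
    next
      case (Suc k)
      define H where "H = {x \<in> carrier R. \<forall>xs. set xs \<subseteq> carrier S \<longrightarrow> length xs = N - Suc k \<longrightarrow>
            foldl (\<otimes>\<^bsub>S\<^esub>) (D c x) xs = \<zero>\<^bsub>S\<^esub>}"
      have "additive_subgroup H R"
        by (rule R.additive_subgroupI_minus)
          (auto simp: H_def D_zero_r cR D_r S.foldl_mult_zero S.foldl_mult_diff DS S.minus_eq_zero_iff)
      moreover have "C \<subseteq> H"
      proof
        fix d assume d: "d \<in> C"
        have "D c d = \<zero>\<^bsub>S\<^esub>" using D0[of c d] multC[OF c d] cR d C by auto
        then show "d \<in> H" using d C by (auto simp: H_def S.foldl_mult_zero)
      qed
      moreover have "z \<otimes>\<^bsub>R\<^esub> y \<in> H" if zy: "z \<in> carrier R" "y \<in> Y" for z y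
      proof -
        have "foldl (\<otimes>\<^bsub>S\<^esub>) (D c (z \<otimes>\<^bsub>R\<^esub> y)) xs = \<zero>\<^bsub>S\<^esub>"
          if "set xs \<subseteq> carrier S" "length xs = N - Suc k" for xs
        proof -
          \<comment> \<open>\<open>D_mult_r\<close> moves \<open>y\<close> out of the defect to the
            front of the tail, which then has the length \<open>N - k\<close> of the induction
            hypothesis.\<close>
          have "set (\<phi> y # xs) \<subseteq> carrier S" "length (\<phi> y # xs) = N - k"
            using that Suc.prems zy Y closed by auto
          then have "foldl (\<otimes>\<^bsub>S\<^esub>) (D c z) (\<phi> y # xs) = \<zero>\<^bsub>S\<^esub>"
            using Suc.IH Suc.prems zy by (meson Suc_leD)
          then show ?thesis using D_mult_r[OF cR zy] by simp
        qed
        then show ?thesis using zy Y by (auto simp: H_def R.m_closed)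
      qed
      ultimately have "H = carrier R" by (rule gen)
      then show ?case by (auto simp: H_def)
    qed
    from this[of N] have "foldl (\<otimes>\<^bsub>S\<^esub>) (D c x) [] = \<zero>\<^bsub>S\<^esub>" using x by fastforce
    then show ?thesis by simp
  qed
  obtain N where N: "\<And>x xs. x \<in> carrier R \<Longrightarrow> set xs \<subseteq> carrier R \<Longrightarrow> length xs = N
     \<Longrightarrow> foldl (\<otimes>\<^bsub>R\<^esub>) x xs = \<zero>\<^bsub>R\<^esub>"
    using nilpotent_rngD[OF R] by blast
  \<comment> \<open>The same descent, now with nilpotency of \<open>R\<close> and with the long
    product as second argument of \<open>D\<close>.\<close>
  have "\<forall>a\<in>carrier R. \<forall>xs. set xs \<subseteq> carrier R \<longrightarrow> length xs = N - k \<longrightarrow>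
          (\<forall>x\<in>carrier R. D x (foldl (\<otimes>\<^bsub>R\<^esub>) a xs) = \<zero>\<^bsub>S\<^esub>)" if "k \<le> N" for k
    using that
  proof (induction k)
    case 0
    then show ?case using N D_zero_r by simp
  next
    case (Suc k)
    show ?case
    proof (intro ballI allI impI)
      fix a xs x assume a: "a \<in> carrier R" "set xs \<subseteq> carrier R" "length xs = N - Suc k"
        and x: "x \<in> carrier R"
      define b where "b = foldl (\<otimes>\<^bsub>R\<^esub>) a xs"
      have b: "b \<in> carrier R" using a by (simp add: b_def R.foldl_mult_closed)
      define H where "H = {x \<in> carrier R. D x b = \<zero>\<^bsub>S\<^esub>}"
      have "additive_subgroup H R"
        by (rule R.additive_subgroupI_minus)
          (auto simp: H_def D_zero_l b D_l DS S.minus_eq_zero_iff)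
      moreover have "C \<subseteq> H" using D_C b C by (auto simp: H_def)
      moreover have "z \<otimes>\<^bsub>R\<^esub> y \<in> H" if zy: "z \<in> carrier R" "y \<in> Y" for z y
      proof -
        have y: "y \<in> carrier R" using zy Y by auto
        \<comment> \<open>\<open>D_mult_l\<close> passes \<open>y\<close> on to \<open>b\<close>,
          giving a product with one more factor.\<close>
        have "D (z \<otimes>\<^bsub>R\<^esub> y) b = D z (foldl (\<otimes>\<^bsub>R\<^esub>) y (a # xs))"
          using D_mult_l[OF b zy] R.mult_foldl_mult[OF y a(1,2)] by (simp add: b_def)
        also have "\<dots> = \<zero>\<^bsub>S\<^esub>"
        proof -
          have "set (a # xs) \<subseteq> carrier R" "length (a # xs) = N - k" using a Suc.prems by auto
          then show ?thesis using Suc.IH Suc.prems y zy(1) by (meson Suc_leD)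
        qed
        finally show ?thesis using zy y by (auto simp: H_def R.m_closed)
      qed
      ultimately have "H = carrier R" by (rule gen)
      then show "D x (foldl (\<otimes>\<^bsub>R\<^esub>) a xs) = \<zero>\<^bsub>S\<^esub>" using x by (auto simp: H_def b_def)
    qed
  qed
  from this[of N] have "D x (foldl (\<otimes>\<^bsub>R\<^esub>) y []) = \<zero>\<^bsub>S\<^esub>" using xy by fastforce
  then show ?thesis using D0 xy by simp
qed

text \<open>
  A code \<open>(M, Y, L, Q, C, S, J, U, W)\<close> lists digits with respect to a basis \<open>a\<close> with relations \<open>M\<close>: \<open>Y\<close> those of
  the elements \<open>y\<close>, \<open>L\<close> and \<open>Q\<close> those of the products \<open>y a\<close> and \<open>a y\<close>, \<open>C\<close> those of the generators \<open>c\<close> modulo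
  the subgroup generated by the \<open>R y\<close>, \<open>J\<close> those of a basis of that subgroup, and \<open>S (i, \<cdot>)\<close> those of elements
  that generate \<open>R c\<^sub>i\<close> modulo it.  The product of \<open>c\<^sub>j\<close> and \<open>c\<^sub>i\<close> has coefficients \<open>U (j, i)\<close> and \<open>W (j, i)\<close>
  in terms of \<open>J\<close> and \<open>S (i)\<close>.
\<close>

type_synonym ring_code =
  "(nat \<times> nat \<Rightarrow> int) \<times> (nat \<times> nat \<Rightarrow> int) \<times> (nat \<times> nat \<times> nat \<Rightarrow> int) \<times> (nat \<times> nat \<times> nat \<Rightarrow> int) \<times>
   (nat \<times> nat \<Rightarrow> int) \<times> (nat \<times> nat \<times> nat \<Rightarrow> int) \<times> (nat \<times> nat \<Rightarrow> int) \<times>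
   (nat \<times> nat \<times> nat \<Rightarrow> int) \<times> (nat \<times> nat \<times> nat \<Rightarrow> int)"

text \<open>Generation is stated through the products \<open>z y\<close> rather than through a
  subgroup, in the form in which \<open>multiplicative_by_nilpotency\<close> asks for it.\<close>

fun encodes :: "nat \<Rightarrow> nat \<Rightarrow> nat \<Rightarrow> nat \<Rightarrow> ring_code \<Rightarrow> ('a, 'm) ring_scheme \<Rightarrow> bool" where
  "encodes p s n e (M, Y, L, Q, C, S, J, U, W) R \<longleftrightarrow>
     (\<exists>a. pbasis p R n (\<lambda>i j. M (i, j)) a \<and>
       (\<forall>k<s. \<forall>j<n.
          lincomb R a (\<lambda>i. Y (k, i)) n \<otimes>\<^bsub>R\<^esub> a j = lincomb R a (\<lambda>i. L (k, j, i)) n \<and>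
          a j \<otimes>\<^bsub>R\<^esub> lincomb R a (\<lambda>i. Y (k, i)) n = lincomb R a (\<lambda>i. Q (k, j, i)) n) \<and>
       (\<forall>H. additive_subgroup H R \<longrightarrow>
          (\<forall>i<n - e. lincomb R a (\<lambda>j. C (i, j)) n \<in> H) \<longrightarrow>
          (\<forall>z\<in>carrier R. \<forall>k<s. z \<otimes>\<^bsub>R\<^esub> lincomb R a (\<lambda>i. Y (k, i)) n \<in> H) \<longrightarrow> H = carrier R) \<and>
       (\<forall>j<n - e. \<forall>i<n - e.
          lincomb R a (\<lambda>m. C (j, m)) n \<otimes>\<^bsub>R\<^esub> lincomb R a (\<lambda>m. C (i, m)) n =
          lincomb R (\<lambda>l. lincomb R a (\<lambda>m. J (l, m)) n) (\<lambda>l. U (j, i, l)) e \<oplus>\<^bsub>R\<^esub>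
          lincomb R (\<lambda>l. lincomb R a (\<lambda>m. S (i, l, m)) n) (\<lambda>l. W (j, i, l)) s))"

text \<open>The shared relations \<open>M\<close> give an additive isomorphism matching the two
  bases. The shared digits make it respect products with each \<open>y\<close> and products of the
  \<open>c\<close>, and nilpotency extends this to all products.\<close>

lemma encodes_unique:
  assumes R: "nilpotent_rng R" and S: "nilpotent_rng S"
    and cR: "encodes p s n e c R" and cS: "encodes p s n e c S"
  shows "rng_iso R S \<noteq> {}"
proof -
  interpret R: rng R using R by (simp add: nilpotent_rng_def)
  interpret S: rng S using S by (simp add: nilpotent_rng_def)
  \<comment> \<open>\<open>T\<close> is the component written \<open>S\<close> in
    \<open>encodes\<close>, since \<open>S\<close> names a ring here.\<close>
  obtain M Y L Q C T J U W where c: "c = (M, Y, L, Q, C, T, J, U, W)" by (metis prod.exhaust)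
  obtain a where a: "pbasis p R n (\<lambda>i j. M (i, j)) a"
    and yR: "\<forall>k<s. \<forall>j<n.
      lincomb R a (\<lambda>i. Y (k, i)) n \<otimes>\<^bsub>R\<^esub> a j = lincomb R a (\<lambda>i. L (k, j, i)) n \<and>
      a j \<otimes>\<^bsub>R\<^esub> lincomb R a (\<lambda>i. Y (k, i)) n = lincomb R a (\<lambda>i. Q (k, j, i)) n"
    and gen: "\<forall>H. additive_subgroup H R \<longrightarrow>
          (\<forall>i<n - e. lincomb R a (\<lambda>j. C (i, j)) n \<in> H) \<longrightarrow>
          (\<forall>z\<in>carrier R. \<forall>k<s. z \<otimes>\<^bsub>R\<^esub> lincomb R a (\<lambda>i. Y (k, i)) n \<in> H) \<longrightarrow> H = carrier R"
    and ccR: "\<forall>j<n - e. \<forall>i<n - e.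
          lincomb R a (\<lambda>m. C (j, m)) n \<otimes>\<^bsub>R\<^esub> lincomb R a (\<lambda>m. C (i, m)) n =
          lincomb R (\<lambda>l. lincomb R a (\<lambda>m. J (l, m)) n) (\<lambda>l. U (j, i, l)) e \<oplus>\<^bsub>R\<^esub>
          lincomb R (\<lambda>l. lincomb R a (\<lambda>m. T (i, l, m)) n) (\<lambda>l. W (j, i, l)) s"
    using cR unfolding c encodes.simps by (elim exE conjE) (rule that)
  obtain b where b: "pbasis p S n (\<lambda>i j. M (i, j)) b"
    and yS: "\<forall>k<s. \<forall>j<n.
      lincomb S b (\<lambda>i. Y (k, i)) n \<otimes>\<^bsub>S\<^esub> b j = lincomb S b (\<lambda>i. L (k, j, i)) n \<and>
      b j \<otimes>\<^bsub>S\<^esub> lincomb S b (\<lambda>i. Y (k, i)) n = lincomb S b (\<lambda>i. Q (k, j, i)) n"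
    and ccS: "\<forall>j<n - e. \<forall>i<n - e.
          lincomb S b (\<lambda>m. C (j, m)) n \<otimes>\<^bsub>S\<^esub> lincomb S b (\<lambda>m. C (i, m)) n =
          lincomb S (\<lambda>l. lincomb S b (\<lambda>m. J (l, m)) n) (\<lambda>l. U (j, i, l)) e \<oplus>\<^bsub>S\<^esub>
          lincomb S (\<lambda>l. lincomb S b (\<lambda>m. T (i, l, m)) n) (\<lambda>l. W (j, i, l)) s"
    using cS unfolding c encodes.simps by (elim exE conjE) (rule that)
  obtain \<phi> where bij: "bij_betw \<phi> (carrier R) (carrier S)"
    and add: "\<And>x y. x \<in> carrier R \<Longrightarrow> y \<in> carrier R \<Longrightarrow> \<phi> (x \<oplus>\<^bsub>R\<^esub> y) = \<phi> x \<oplus>\<^bsub>S\<^esub> \<phi> y"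
    and \<phi>: "\<And>v. \<phi> (lincomb R a v n) = lincomb S b v n"
    using pbasis_isomorphism[OF R.abelian_group_axioms S.abelian_group_axioms a b] by blast
  have closed: "\<phi> x \<in> carrier S" if "x \<in> carrier R" for x
    using bij that by (auto simp: bij_betw_def)
  have ac: "a i \<in> carrier R" "b i \<in> carrier S" if "i < n" for i
    using a b that by (auto simp: pbasis_def)
  have lc: "lincomb R a v n \<in> carrier R" "lincomb S b v n \<in> carrier S" for v
    using ac by auto
  have hom: "\<phi> (lincomb R u v k) = lincomb S (\<lambda>i. \<phi> (u i)) v k"
    if "\<And>i. i < k \<Longrightarrow> u i \<in> carrier R" for u v k
    using additive_map_lincomb[OF R.abelian_group_axioms S.abelian_group_axioms closed add that] .
  have Rr: "lincomb R u v k \<otimes>\<^bsub>R\<^esub> w = lincomb R (\<lambda>i. u i \<otimes>\<^bsub>R\<^esub> w) v k"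
    and Rl: "w \<otimes>\<^bsub>R\<^esub> lincomb R u v k = lincomb R (\<lambda>i. w \<otimes>\<^bsub>R\<^esub> u i) v k"
    if "w \<in> carrier R" "\<And>i. i < k \<Longrightarrow> u i \<in> carrier R" for u v k w
    using that additive_map_lincomb[OF R.abelian_group_axioms R.abelian_group_axioms, of "\<lambda>x. x \<otimes>\<^bsub>R\<^esub> w"]
      additive_map_lincomb[OF R.abelian_group_axioms R.abelian_group_axioms, of "\<lambda>x. w \<otimes>\<^bsub>R\<^esub> x"]
    by (simp_all add: R.m_closed R.l_distr R.r_distr)
  have Sr: "lincomb S u v k \<otimes>\<^bsub>S\<^esub> w = lincomb S (\<lambda>i. u i \<otimes>\<^bsub>S\<^esub> w) v k"
    and Sl: "w \<otimes>\<^bsub>S\<^esub> lincomb S u v k = lincomb S (\<lambda>i. w \<otimes>\<^bsub>S\<^esub> u i) v k"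
    if "w \<in> carrier S" "\<And>i. i < k \<Longrightarrow> u i \<in> carrier S" for u v k w
    using that additive_map_lincomb[OF S.abelian_group_axioms S.abelian_group_axioms, of "\<lambda>x. x \<otimes>\<^bsub>S\<^esub> w"]
      additive_map_lincomb[OF S.abelian_group_axioms S.abelian_group_axioms, of "\<lambda>x. w \<otimes>\<^bsub>S\<^esub> x"]
    by (simp_all add: S.m_closed S.l_distr S.r_distr)
  define y where "y k = lincomb R a (\<lambda>i. Y (k, i)) n" for k
  define z where "z k = lincomb S b (\<lambda>i. Y (k, i)) n" for k
  have yz: "y k \<in> carrier R" "z k \<in> carrier S" "\<phi> (y k) = z k" for k
    using lc \<phi> by (simp_all add: y_def z_def)
  have multY: "\<phi> (w \<otimes>\<^bsub>R\<^esub> y k) = \<phi> w \<otimes>\<^bsub>S\<^esub> \<phi> (y k)" "\<phi> (y k \<otimes>\<^bsub>R\<^esub> w) = \<phi> (y k) \<otimes>\<^bsub>S\<^esub> \<phi> w"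
    if "w \<in> carrier R" "k < s" for w k
  proof -
    obtain v where v: "w = lincomb R a v n" using a \<open>w \<in> carrier R\<close> by (auto simp: pbasis_def)
    have "\<phi> (w \<otimes>\<^bsub>R\<^esub> y k) = lincomb S (\<lambda>j. \<phi> (a j \<otimes>\<^bsub>R\<^esub> y k)) v n"
      using ac yz unfolding v by (simp add: Rr hom R.m_closed)
    also have "\<dots> = lincomb S (\<lambda>j. b j \<otimes>\<^bsub>S\<^esub> z k) v n"
      using that(2) by (intro lincomb_cong) (simp_all add: y_def z_def yR yS \<phi>)
    also have "\<dots> = \<phi> w \<otimes>\<^bsub>S\<^esub> \<phi> (y k)"
      using ac yz unfolding v by (simp add: Sr \<phi>)
    finally show "\<phi> (w \<otimes>\<^bsub>R\<^esub> y k) = \<phi> w \<otimes>\<^bsub>S\<^esub> \<phi> (y k)" .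
    have "\<phi> (y k \<otimes>\<^bsub>R\<^esub> w) = lincomb S (\<lambda>j. \<phi> (y k \<otimes>\<^bsub>R\<^esub> a j)) v n"
      using ac yz unfolding v by (simp add: Rl hom R.m_closed)
    also have "\<dots> = lincomb S (\<lambda>j. z k \<otimes>\<^bsub>S\<^esub> b j) v n"
      using that(2) by (intro lincomb_cong) (simp_all add: y_def z_def yR yS \<phi>)
    also have "\<dots> = \<phi> (y k) \<otimes>\<^bsub>S\<^esub> \<phi> w"
      using ac yz unfolding v by (simp add: Sl \<phi>)
    finally show "\<phi> (y k \<otimes>\<^bsub>R\<^esub> w) = \<phi> (y k) \<otimes>\<^bsub>S\<^esub> \<phi> w" .
  qed
  define D where "D = (\<lambda>i. lincomb R a (\<lambda>m. C (i, m)) n) ` {..<n - e}"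
  have multD: "\<phi> (c \<otimes>\<^bsub>R\<^esub> d) = \<phi> c \<otimes>\<^bsub>S\<^esub> \<phi> d" if "c \<in> D" "d \<in> D" for c d
  proof -
    from that obtain i j where ij: "c = lincomb R a (\<lambda>m. C (j, m)) n" "d = lincomb R a (\<lambda>m. C (i, m)) n"
      "i < n - e" "j < n - e" by (auto simp: D_def)
    show ?thesis
      unfolding ij(1,2) by (simp add: ccR ccS ij(3,4) add lc hom \<phi>)
  qed
  have "\<phi> (u \<otimes>\<^bsub>R\<^esub> v) = \<phi> u \<otimes>\<^bsub>S\<^esub> \<phi> v" if "u \<in> carrier R" "v \<in> carrier R" for u v
  proof (rule multiplicative_by_nilpotency[OF R S closed add, where C = D and Y = "y ` {..<s}"])
    fix H assume H: "additive_subgroup H R" "D \<subseteq> H"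
      "\<And>z x. z \<in> carrier R \<Longrightarrow> x \<in> y ` {..<s} \<Longrightarrow> z \<otimes>\<^bsub>R\<^esub> x \<in> H"
    show "H = carrier R"
      by (intro gen[rule_format] H(1)) (use H(2,3) in \<open>auto simp: D_def y_def\<close>)
  next
    show "D \<subseteq> carrier R" using lc by (auto simp: D_def)
  next
    show "y ` {..<s} \<subseteq> carrier R" using yz by auto
  next
    fix w x assume "w \<in> carrier R" "x \<in> y ` {..<s}"
    then show "\<phi> (w \<otimes>\<^bsub>R\<^esub> x) = \<phi> w \<otimes>\<^bsub>S\<^esub> \<phi> x" "\<phi> (x \<otimes>\<^bsub>R\<^esub> w) = \<phi> x \<otimes>\<^bsub>S\<^esub> \<phi> w"
      using multY by auto
  qed (use that multD in blast)+
  then show ?thesis using bij add by (auto simp: rng_iso_def)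
qed

section \<open>Existence of codes for rings of order \<open>p^n\<close>\<close>

lemma lincomb_pad:
  assumes "abelian_group R" "\<And>i. i < k \<Longrightarrow> a i \<in> carrier R" "k \<le> s" "\<And>i. k \<le> i \<Longrightarrow> i < s \<Longrightarrow> a i = \<zero>\<^bsub>R\<^esub>"
  shows "lincomb R a v s = lincomb R a v k"
proof -
  interpret abelian_group R by fact
  show ?thesis
    using assms(3,4)
  proof (induction s)
    case (Suc s)
    then show ?case using assms(2) by (cases "k = Suc s") auto
  qed simp
qed

lemma (in abelian_group) additive_subgroup_carrier: "additive_subgroup (carrier G) G"
  by (rule additive_subgroupI_minus) auto

lemma (in abelian_group) additive_subgroup_zero: "additive_subgroup {\<zero>} G"
  by (rule additive_subgroupI_minus) (auto simp: minus_eq_zero_iff)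

lemma (in abelian_group) card_additive_subgroup:
  assumes "additive_subgroup H G" "card (carrier G) = p ^ n" "prime p"
  shows "\<exists>e\<le>n. card H = p ^ e"
proof -
  have "card H dvd p ^ n"
    using group.lagrange[OF a_group additive_subgroup.a_subgroup[OF assms(1)]] assms(2)
    by (metis dvd_triv_right order_def partial_object.select_convs(1))
  then show ?thesis using assms(3) by (simp add: divides_primepow_nat)
qed

text \<open>
  Take a list of maximal length \<open>l\<close> among those for which \<open>J\<close> has at least \<open>p\<^sup>s\<^sup>l\<close> elements.
\<close>

lemma (in rng) small_right_cover:
  assumes card: "card (carrier R) = p ^ n" and p: "prime p" and s: "n \<le> s * s" "s > 0"
  shows "\<exists>y J. (\<forall>k<s. y k \<in> carrier R) \<and> additive_subgroup J R \<and>
     (\<forall>H. additive_subgroup H R \<longrightarrow> (\<forall>z\<in>carrier R. \<forall>k<s. z \<otimes> y k \<in> H) \<longrightarrow> J \<subseteq> H) \<and>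
     (\<forall>x\<in>carrier R. \<exists>K. additive_subgroup K R \<and> J \<subseteq> K \<and> (\<forall>z\<in>carrier R. z \<otimes> x \<in> K) \<and>
        card K \<le> p ^ s * card J)"
proof -
  define P where "P ys = {z \<otimes> y |z y. z \<in> carrier R \<and> y \<in> set ys}" for ys
  define I where "I ys = generate (add_monoid R) (P ys)" for ys
  define good where "good ys \<longleftrightarrow> set ys \<subseteq> carrier R \<and> p ^ (s * length ys) \<le> card (I ys)" for ys
  have fin: "finite (carrier R)"
    using card prime_gt_0_nat[OF p] by (metis card_ge_0_finite zero_less_power)
  have PR: "P ys \<subseteq> carrier R" if "set ys \<subseteq> carrier R" for ys
    using that by (auto simp: P_def m_closed)
  have I: "additive_subgroup (I ys) R" "I ys \<subseteq> carrier R" "P ys \<subseteq> I ys" if "set ys \<subseteq> carrier R" for ys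
  proof -
    show sub: "additive_subgroup (I ys) R"
      using add.generate_is_subgroup[OF PR[OF that]] by (simp add: I_def additive_subgroup_def)
    show "I ys \<subseteq> carrier R" using sub by (rule additive_subgroup.a_subset)
    show "P ys \<subseteq> I ys" by (auto simp: I_def intro: generate.incl)
  qed
  have Imin: "I ys \<subseteq> H" if "additive_subgroup H R" "P ys \<subseteq> H" for ys H
    using add.generate_subgroup_incl[OF that(2) additive_subgroup.a_subgroup[OF that(1)]] by (simp add: I_def)
  have "good []"
  proof -
    have "\<zero> \<in> I []" "finite (I [])"
      using additive_subgroup.zero_closed[OF I(1)[of "[]"]] finite_subset[OF I(2)[of "[]"] fin] by simp_all
    then have "card (I []) > 0" using card_gt_0_iff by blast
    then show ?thesis by (simp add: good_def)
  qed
  \<comment> \<open>A good list of length \<open>l\<close> needs \<open>p^(s l)\<close> of the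
    \<open>p^n\<close> elements, so \<open>n \<le> s * s\<close> will cap \<open>l\<close> at
    \<open>s\<close>.\<close>
  have bound: "s * length ys \<le> n" if "good ys" for ys
  proof -
    have "p ^ (s * length ys) \<le> p ^ n"
      using that card_mono[OF fin I(2)[of ys]] card by (auto simp: good_def)
    then show ?thesis by (rule power_le_imp_le_exp[OF prime_gt_1_nat[OF p]])
  qed
  have "\<forall>ys. good ys \<longrightarrow> length ys \<le> n"
  proof (intro allI impI)
    fix ys assume "good ys"
    have "length ys \<le> s * length ys" using s by simp
    then show "length ys \<le> n" using bound[OF \<open>good ys\<close>] by linarith
  qed
  then obtain ys where ys: "good ys" and max: "\<And>zs. good zs \<Longrightarrow> length zs \<le> length ys"
    using ex_has_greatest_nat[of good "[]" length "Suc n"] \<open>good []\<close> by (auto simp: less_Suc_eq_le)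
  have ysR: "set ys \<subseteq> carrier R" using ys by (simp add: good_def)
  have len: "length ys \<le> s"
  proof (rule ccontr)
    assume "\<not> length ys \<le> s"
    then have "s * s < s * length ys" using s by simp
    then show False using bound[OF ys] s by linarith
  qed
  \<comment> \<open>Padding with zero gives exactly \<open>s\<close> entries and contributes only
    the products \<open>z 0 = 0\<close>.\<close>
  define y where "y k = (if k < length ys then ys ! k else \<zero>)" for k
  have cover: "\<exists>K. additive_subgroup K R \<and> I ys \<subseteq> K \<and> (\<forall>z\<in>carrier R. z \<otimes> x \<in> K) \<and>
        card K \<le> p ^ s * card (I ys)" if x: "x \<in> carrier R" for x
  proof (intro exI[of _ "I (x # ys)"] conjI ballI)
    have xys: "set (x # ys) \<subseteq> carrier R" using x ysR by simp
    show "additive_subgroup (I (x # ys)) R" by (rule I(1)[OF xys])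
    show "I ys \<subseteq> I (x # ys)"
      using I(3)[OF xys] by (intro Imin I(1)[OF xys]) (auto simp: P_def)
    show "z \<otimes> x \<in> I (x # ys)" if "z \<in> carrier R" for z
      using I(3)[OF xys] that by (auto simp: P_def)
    \<comment> \<open>By maximality the longer list misses its threshold
      \<open>p^(s (l + 1))\<close>, which is at most \<open>p^s\<close> times the order of
      \<open>I ys\<close>.\<close>
    have "\<not> good (x # ys)" using max[of "x # ys"] by auto
    then have "card (I (x # ys)) \<le> p ^ (s * Suc (length ys))" using xys by (auto simp: good_def)
    also have "\<dots> = p ^ s * p ^ (s * length ys)" by (simp add: power_add)
    also have "\<dots> \<le> p ^ s * card (I ys)" using ys by (simp add: good_def)
    finally show "card (I (x # ys)) \<le> p ^ s * card (I ys)" .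
  qed
  have min: "I ys \<subseteq> H" if "additive_subgroup H R" "\<And>z k. z \<in> carrier R \<Longrightarrow> k < s \<Longrightarrow> z \<otimes> y k \<in> H" for H
  proof (rule Imin[OF that(1)])
    show "P ys \<subseteq> H"
    proof
      fix u assume "u \<in> P ys"
      then obtain z k where "u = z \<otimes> ys ! k" "z \<in> carrier R" "k < length ys"
        by (auto simp: P_def in_set_conv_nth)
      then show "u \<in> H" using that(2)[of z k] len by (simp add: y_def)
    qed
  qed
  have yR: "\<forall>k<s. y k \<in> carrier R" using ysR by (auto simp: y_def)
  show ?thesis
  proof (rule exI[where x = y], rule exI[where x = "I ys"], intro conjI)
    show "\<forall>H. additive_subgroup H R \<longrightarrow> (\<forall>z\<in>carrier R. \<forall>k<s. z \<otimes> y k \<in> H) \<longrightarrow> I ys \<subseteq> H"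
      using min by blast
  qed (use yR I(1)[OF ysR] cover in auto)
qed

text \<open>Extensional functions are fixed off \<open>I\<close>, so for finite \<open>I\<close>
  there are exactly \<open>p ^ card I\<close> arrays.\<close>

abbreviation digit_arrays :: "nat \<Rightarrow> 'i set \<Rightarrow> ('i \<Rightarrow> int) set" where
  "digit_arrays p I \<equiv> I \<rightarrow>\<^sub>E {0..<int p}"

text \<open>The main term comes from \<open>U\<close>, with \<open>(n - e)^2 e\<close> entries.
  Every other index set has at most \<open>s n^2\<close> elements when \<open>e \<le> n\<close> and
  \<open>s \<ge> 1\<close>.\<close>

definition ring_codes :: "nat \<Rightarrow> nat \<Rightarrow> nat \<Rightarrow> nat \<Rightarrow> ring_code set" where
  "ring_codes p s n e =
     digit_arrays p ({..<n} \<times> {..<n}) \<times> digit_arrays p ({..<s} \<times> {..<n}) \<times>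
     digit_arrays p ({..<s} \<times> {..<n} \<times> {..<n}) \<times> digit_arrays p ({..<s} \<times> {..<n} \<times> {..<n}) \<times>
     digit_arrays p ({..<n - e} \<times> {..<n}) \<times> digit_arrays p ({..<n - e} \<times> {..<s} \<times> {..<n}) \<times>
     digit_arrays p ({..<e} \<times> {..<n}) \<times>
     digit_arrays p ({..<n - e} \<times> {..<n - e} \<times> {..<e}) \<times>
     digit_arrays p ({..<n - e} \<times> {..<n - e} \<times> {..<s})"

text \<open>This is \<open>prime_power_chain\<close> started at the zero subgroup, with the digits
  of the multiples \<open>p a_i\<close> collected in a matrix.\<close>

lemma (in abelian_group) prime_power_basis:
  assumes K: "additive_subgroup K G" and fin: "finite K" and p: "prime p" and cardK: "card K = p ^ m"
    and tors: "\<And>x. x \<in> K \<Longrightarrow> [int (p ^ N)] \<cdot> x = \<zero>"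
  shows "\<exists>a M. (\<forall>i<m. a i \<in> K) \<and> (\<forall>x\<in>K. \<exists>v\<in>digit_funs p. x = lincomb G a v m) \<and>
           (\<forall>i<m. M i \<in> digit_funs p \<and> [int p] \<cdot> a i = lincomb G a (M i) i) \<and>
           (\<forall>i<m. \<forall>v. lincomb G a v (Suc i) = \<zero> \<longrightarrow> int p dvd v i)"
proof -
  have KG: "K \<subseteq> carrier G" using K by (rule additive_subgroup.a_subset)
  have "\<exists>a. (\<forall>i<m. a i \<in> K) \<and>
           (\<forall>x\<in>K. \<exists>h\<in>{\<zero>}. \<exists>v\<in>digit_funs p. x = h \<oplus> lincomb G a v m) \<and>
           (\<forall>i<m. \<exists>h\<in>{\<zero>}. \<exists>v\<in>digit_funs p. [int p] \<cdot> a i = h \<oplus> lincomb G a v i) \<and>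
           (\<forall>i<m. \<forall>h\<in>{\<zero>}. \<forall>v. h \<oplus> lincomb G a v (Suc i) = \<zero> \<longrightarrow> int p dvd v i)"
    by (rule prime_power_chain[OF additive_subgroup_zero K _ fin p])
      (use cardK tors additive_subgroup.zero_closed[OF K] in simp_all)
  then obtain a where a: "\<forall>i<m. a i \<in> K"
     "\<forall>x\<in>K. \<exists>h\<in>{\<zero>}. \<exists>v\<in>digit_funs p. x = h \<oplus> lincomb G a v m"
     "\<forall>i<m. \<exists>h\<in>{\<zero>}. \<exists>v\<in>digit_funs p. [int p] \<cdot> a i = h \<oplus> lincomb G a v i"
     "\<forall>i<m. \<forall>h\<in>{\<zero>}. \<forall>v. h \<oplus> lincomb G a v (Suc i) = \<zero> \<longrightarrow> int p dvd v i"
    by blast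
  have l0: "\<zero> \<oplus> lincomb G a v i = lincomb G a v i" if "i \<le> m" for i v
    using a(1) that KG by (intro l_zero lincomb_closed) auto
  have "\<forall>i. \<exists>v. i < m \<longrightarrow> v \<in> digit_funs p \<and> [int p] \<cdot> a i = lincomb G a v i"
    using a(3) l0 by (metis less_imp_le singletonD)
  then obtain M where M: "\<forall>i. i < m \<longrightarrow> M i \<in> digit_funs p \<and> [int p] \<cdot> a i = lincomb G a (M i) i"
    by metis
  have "\<forall>x\<in>K. \<exists>v\<in>digit_funs p. x = lincomb G a v m"
    using a(2) l0[of m] by simp
  moreover have "\<forall>i<m. \<forall>v. lincomb G a v (Suc i) = \<zero> \<longrightarrow> int p dvd v i"
    using a(4) l0 by (simp del: lincomb.simps)
  ultimately show ?thesis using a(1) M by blast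
qed

lemma (in abelian_group) prime_power_generators:
  assumes H: "additive_subgroup H G" and K: "additive_subgroup K G" and HK: "H \<subseteq> K"
    and fin: "finite K" and p: "prime p" and cardK: "card K = p ^ m * card H"
    and tors: "\<And>x. x \<in> K \<Longrightarrow> [int (p ^ N)] \<cdot> x = \<zero>"
  shows "\<exists>a. (\<forall>i<m. a i \<in> K) \<and> (\<forall>x\<in>K. \<exists>h\<in>H. \<exists>v\<in>digit_funs p. x = h \<oplus> lincomb G a v m)"
proof -
  have "[int (p ^ N)] \<cdot> x \<in> H" if "x \<in> K" for x
    using tors[OF that] additive_subgroup.zero_closed[OF H] by simp
  from prime_power_chain[OF H K HK fin p cardK this] show ?thesis by blast
qed

text \<open>Most data are written with \<open>n\<close> digits in the basis \<open>a\<close>.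
  Products of the \<open>c\<close> instead use a basis \<open>b\<close> of \<open>J\<close> and
  \<open>s\<close> elements \<open>d\<close> whose combinations reach \<open>R c_i\<close> modulo
  \<open>J\<close>, so that each takes \<open>e + s\<close> digits.\<close>

lemma code_exists:
  fixes R (structure)
  assumes "rng R" and card: "card (carrier R) = p ^ n" and p: "prime p" and s: "n \<le> s * s" "s > 0"
  shows "\<exists>e\<le>n. \<exists>c\<in>ring_codes p s n e. encodes p s n e c R"
proof -
  interpret rng R by fact
  have fin: "finite (carrier R)"
    using card prime_gt_0_nat[OF p] by (metis card_ge_0_finite zero_less_power)
  have tors: "[int (p ^ n)] \<cdot> x = \<zero>" if "x \<in> carrier R" for x
  proof -
    have "x [^]\<^bsub>add_monoid R\<^esub> order (add_monoid R) = \<zero>"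
      using group.pow_order_eq_1[OF a_group, of x] that by simp
    then show ?thesis using card by (simp add: order_def add_pow_def int_pow_int del: of_nat_power)
  qed
  obtain y J where y': "\<forall>k<s. y k \<in> carrier R" and J: "additive_subgroup J R"
    and min': "\<forall>H. additive_subgroup H R \<longrightarrow> (\<forall>z\<in>carrier R. \<forall>k<s. z \<otimes> y k \<in> H) \<longrightarrow> J \<subseteq> H"
    and cover': "\<forall>x\<in>carrier R. \<exists>K. additive_subgroup K R \<and> J \<subseteq> K \<and> (\<forall>z\<in>carrier R. z \<otimes> x \<in> K) \<and>
        card K \<le> p ^ s * card J"
    using small_right_cover[OF card p s] by (elim exE conjE) (rule that)
  note y = y'[rule_format] and min = min'[rule_format] and cover = cover'[rule_format]
  have JR: "J \<subseteq> carrier R" using J by (rule additive_subgroup.a_subset)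
  obtain e where e: "e \<le> n" "card J = p ^ e"
    using card_additive_subgroup[OF J card p] by blast
  obtain a M where a: "\<forall>i<n. a i \<in> carrier R"
     "\<forall>x\<in>carrier R. \<exists>v\<in>digit_funs p. x = lincomb R a v n"
     "\<forall>i<n. M i \<in> digit_funs p \<and> [int p] \<cdot> a i = lincomb R a (M i) i"
     "\<forall>i<n. \<forall>v. lincomb R a v (Suc i) = \<zero> \<longrightarrow> int p dvd v i"
    using prime_power_basis[OF additive_subgroup_carrier fin p card tors] by blast
  then have M: "\<And>i. i < n \<Longrightarrow> M i \<in> digit_funs p" "\<And>i. i < n \<Longrightarrow> [int p] \<cdot> a i = lincomb R a (M i) i"
    by blast+
  obtain \<kappa> where \<kappa>: "\<And>x. x \<in> carrier R \<Longrightarrow> \<kappa> x \<in> digit_funs p" "\<And>x. x \<in> carrier R \<Longrightarrow> lincomb R a (\<kappa> x) n = x"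
  proof -
    have "\<forall>x\<in>carrier R. \<exists>v. v \<in> digit_funs p \<and> lincomb R a v n = x"
      using a(2) by metis
    from bchoice[OF this] show ?thesis using that by blast
  qed
  obtain b where b: "\<And>i. i < e \<Longrightarrow> b i \<in> J" "\<And>x. x \<in> J \<Longrightarrow> \<exists>v\<in>digit_funs p. x = lincomb R b v e"
  proof -
    have "[int (p ^ n)] \<cdot> x = \<zero>" if "x \<in> J" for x using tors that JR by blast
    from prime_power_basis[OF J finite_subset[OF JR fin] p e(2) this] show ?thesis using that by blast
  qed
  obtain c where c: "\<And>i. i < n - e \<Longrightarrow> c i \<in> carrier R"
    "\<And>x. x \<in> carrier R \<Longrightarrow> \<exists>h\<in>J. \<exists>v\<in>digit_funs p. x = h \<oplus> lincomb R c v (n - e)"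
  proof -
    have "card (carrier R) = p ^ (n - e) * card J" using e card by (simp flip: power_add)
    from prime_power_generators[OF J additive_subgroup_carrier JR fin p this tors]
    show ?thesis using that by blast
  qed
  have "\<forall>x\<in>carrier R. \<exists>d. (\<forall>l<s. d l \<in> carrier R) \<and>
        (\<forall>z\<in>carrier R. \<exists>h\<in>J. \<exists>v\<in>digit_funs p. z \<otimes> x = h \<oplus> lincomb R d v s)"
  proof
    fix x assume x: "x \<in> carrier R"
    obtain K where K: "additive_subgroup K R" "J \<subseteq> K" "\<forall>z\<in>carrier R. z \<otimes> x \<in> K" "card K \<le> p ^ s * card J"
      using cover[OF x] by blast
    have KR: "K \<subseteq> carrier R" using K(1) by (rule additive_subgroup.a_subset)
    obtain f where f: "card K = p ^ f" using card_additive_subgroup[OF K(1) card p] by blast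
    \<comment> \<open>Comparing \<open>p^e \<le> card K \<le> p^(s + e)\<close> bounds the number
      \<open>f - e\<close> of generators of \<open>K\<close> modulo \<open>J\<close> by
      \<open>s\<close>.\<close>
    have "p ^ e \<le> p ^ f" using card_mono[OF finite_subset[OF KR fin] K(2)] e f by simp
    then have ef: "e \<le> f" by (rule power_le_imp_le_exp[OF prime_gt_1_nat[OF p]])
    have "p ^ f \<le> p ^ (s + e)" using K(4) e f by (simp add: power_add)
    then have "f \<le> s + e" by (rule power_le_imp_le_exp[OF prime_gt_1_nat[OF p]])
    then have "f - e \<le> s" by simp
    have "card K = p ^ (f - e) * card J" using e f ef by (simp flip: power_add)
    moreover have "[int (p ^ n)] \<cdot> x = \<zero>" if "x \<in> K" for x using tors that KR by blast
    ultimately have "\<exists>d. (\<forall>i<f - e. d i \<in> K) \<and>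
        (\<forall>x\<in>K. \<exists>h\<in>J. \<exists>v\<in>digit_funs p. x = h \<oplus> lincomb R d v (f - e))"
      by (rule prime_power_generators[OF J K(1,2) finite_subset[OF KR fin] p])
    then obtain d where d: "\<forall>i<f - e. d i \<in> K"
      "\<forall>x\<in>K. \<exists>h\<in>J. \<exists>v\<in>digit_funs p. x = h \<oplus> lincomb R d v (f - e)" by blast
    \<comment> \<open>Zeros fill the list up to length exactly \<open>s\<close> without changing any
      combination.\<close>
    define d' where "d' i = (if i < f - e then d i else \<zero>)" for i
    have "lincomb R d' v s = lincomb R d v (f - e)" for v
    proof -
      have "lincomb R d' v s = lincomb R d' v (f - e)"
        using \<open>f - e \<le> s\<close> d(1) KR
        by (intro lincomb_pad) (auto simp: d'_def abelian_group_axioms)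
      also have "\<dots> = lincomb R d v (f - e)"
        by (intro lincomb_cong) (auto simp: d'_def)
      finally show ?thesis .
    qed
    moreover have "\<forall>l<s. d' l \<in> carrier R" using d KR by (auto simp: d'_def)
    ultimately show "\<exists>d. (\<forall>l<s. d l \<in> carrier R) \<and>
        (\<forall>z\<in>carrier R. \<exists>h\<in>J. \<exists>v\<in>digit_funs p. z \<otimes> x = h \<oplus> lincomb R d v s)"
      using d(2) K(3) by (intro exI[of _ d']) auto
  qed
  from bchoice[OF this] obtain d where "\<forall>x\<in>carrier R. (\<forall>l<s. d x l \<in> carrier R) \<and>
        (\<forall>z\<in>carrier R. \<exists>h\<in>J. \<exists>v\<in>digit_funs p. z \<otimes> x = h \<oplus> lincomb R (d x) v s)"
    by (rule exE)
  then have d: "\<And>x l. x \<in> carrier R \<Longrightarrow> l < s \<Longrightarrow> d x l \<in> carrier R"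
     "\<And>x z. x \<in> carrier R \<Longrightarrow> z \<in> carrier R \<Longrightarrow> \<exists>h\<in>J. \<exists>v\<in>digit_funs p. z \<otimes> x = h \<oplus> lincomb R (d x) v s"
    by blast+
  \<comment> \<open>Both coefficient vectors of a product are chosen as one pair, indexed by the
    pair of factors: first those over \<open>b\<close>, then those over \<open>d\<close>.\<close>
  have "\<forall>ji\<in>{..<n - e} \<times> {..<n - e}. \<exists>q. fst q \<in> digit_funs p \<and> snd q \<in> digit_funs p \<and>
         c (fst ji) \<otimes> c (snd ji) = lincomb R b (fst q) e \<oplus> lincomb R (d (c (snd ji))) (snd q) s"
  proof
    fix ji assume "ji \<in> {..<n - e} \<times> {..<n - e}"
    then have cc: "c (fst ji) \<in> carrier R" "c (snd ji) \<in> carrier R" using c(1) by auto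
    obtain h w where hw: "h \<in> J" "w \<in> digit_funs p" "c (fst ji) \<otimes> c (snd ji) = h \<oplus> lincomb R (d (c (snd ji))) w s"
      using d(2)[OF cc(2,1)] by blast
    moreover obtain u where "u \<in> digit_funs p" "h = lincomb R b u e" using b(2)[OF hw(1)] by blast
    ultimately show "\<exists>q. fst q \<in> digit_funs p \<and> snd q \<in> digit_funs p \<and>
         c (fst ji) \<otimes> c (snd ji) = lincomb R b (fst q) e \<oplus> lincomb R (d (c (snd ji))) (snd q) s"
      by (intro exI[of _ "(u, w)"]) simp
  qed
  from bchoice[OF this] obtain q where q: "\<forall>ji\<in>{..<n - e} \<times> {..<n - e}.
      fst (q ji) \<in> digit_funs p \<and> snd (q ji) \<in> digit_funs p \<and>
      c (fst ji) \<otimes> c (snd ji) = lincomb R b (fst (q ji)) e \<oplus> lincomb R (d (c (snd ji))) (snd (q ji)) s"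
    by (rule exE)
  define u w where "u j i = fst (q (j, i))" and "w j i = snd (q (j, i))" for j i
  have uw: "u j i \<in> digit_funs p" "w j i \<in> digit_funs p"
     "c j \<otimes> c i = lincomb R b (u j i) e \<oplus> lincomb R (d (c i)) (w j i) s"
    if "j < n - e" "i < n - e" for i j
    using q[rule_format, of "(j, i)"] that by (simp_all add: u_def w_def)
  define M' where "M' = restrict (\<lambda>(i, j). M i j) ({..<n} \<times> {..<n})"
  define Y where "Y = restrict (\<lambda>(k, i). \<kappa> (y k) i) ({..<s} \<times> {..<n})"
  define L where "L = restrict (\<lambda>(k, j, i). \<kappa> (y k \<otimes> a j) i) ({..<s} \<times> {..<n} \<times> {..<n})"
  define Q where "Q = restrict (\<lambda>(k, j, i). \<kappa> (a j \<otimes> y k) i) ({..<s} \<times> {..<n} \<times> {..<n})"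
  define C where "C = restrict (\<lambda>(i, j). \<kappa> (c i) j) ({..<n - e} \<times> {..<n})"
  define S where "S = restrict (\<lambda>(i, l, m). \<kappa> (d (c i) l) m) ({..<n - e} \<times> {..<s} \<times> {..<n})"
  define B where "B = restrict (\<lambda>(l, m). \<kappa> (b l) m) ({..<e} \<times> {..<n})"
  define U where "U = restrict (\<lambda>(j, i, l). u j i l) ({..<n - e} \<times> {..<n - e} \<times> {..<e})"
  define W where "W = restrict (\<lambda>(j, i, l). w j i l) ({..<n - e} \<times> {..<n - e} \<times> {..<s})"
  have bR: "b l \<in> carrier R" if "l < e" for l using b that JR by auto
  have digit: "0 \<le> v i" "v i < int p" if "v \<in> digit_funs p" for v i
    using that by (auto simp: digit_funs_def)
  have "(M', Y, L, Q, C, S, B, U, W) \<in> ring_codes p s n e"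
    unfolding ring_codes_def M'_def Y_def L_def Q_def C_def S_def B_def U_def W_def
    using M \<kappa> uw a(1) y c(1) d(1) bR
    by (auto simp: m_closed intro!: digit)
  moreover have "encodes p s n e (M', Y, L, Q, C, S, B, U, W) R"
  proof -
    have elt: "lincomb R a (\<lambda>i. Y (k, i)) n = y k" if "k < s" for k
      using \<kappa>(2)[OF y[OF that]] that lincomb_cong[of n a a "\<lambda>i. Y (k, i)" "\<kappa> (y k)" R] by (simp add: Y_def)
    have eltL: "lincomb R a (\<lambda>i. L (k, j, i)) n = y k \<otimes> a j" if "k < s" "j < n" for k j
      using \<kappa>(2)[of "y k \<otimes> a j"] y a(1) that lincomb_cong[of n a a "\<lambda>i. L (k, j, i)" "\<kappa> (y k \<otimes> a j)" R]
      by (simp add: L_def m_closed)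
    have eltQ: "lincomb R a (\<lambda>i. Q (k, j, i)) n = a j \<otimes> y k" if "k < s" "j < n" for k j
      using \<kappa>(2)[of "a j \<otimes> y k"] y a(1) that lincomb_cong[of n a a "\<lambda>i. Q (k, j, i)" "\<kappa> (a j \<otimes> y k)" R]
      by (simp add: Q_def m_closed)
    have eltC: "lincomb R a (\<lambda>m. C (i, m)) n = c i" if "i < n - e" for i
      using \<kappa>(2)[OF c(1)[OF that]] that lincomb_cong[of n a a "\<lambda>m. C (i, m)" "\<kappa> (c i)" R] by (simp add: C_def)
    have eltS: "lincomb R a (\<lambda>m. S (i, l, m)) n = d (c i) l" if "i < n - e" "l < s" for i l
      using \<kappa>(2)[OF d(1)[OF c(1)]] that lincomb_cong[of n a a "\<lambda>m. S (i, l, m)" "\<kappa> (d (c i) l)" R]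
      by (simp add: S_def)
    have eltB: "lincomb R a (\<lambda>m. B (l, m)) n = b l" if "l < e" for l
      using \<kappa>(2)[OF bR] that lincomb_cong[of n a a "\<lambda>m. B (l, m)" "\<kappa> (b l)" R] by (simp add: B_def)
    have "pbasis p R n (\<lambda>i j. M' (i, j)) a"
      unfolding pbasis_def
    proof (intro conjI)
      show "\<forall>x\<in>carrier R. \<exists>v\<in>digit_funs p. x = lincomb R a v n" using \<kappa> by metis
      show "\<forall>i<n. [int p] \<cdot> a i = lincomb R a (\<lambda>j. M' (i, j)) i"
      proof (intro allI impI)
        fix i assume "i < n"
        then show "[int p] \<cdot> a i = lincomb R a (\<lambda>j. M' (i, j)) i"
          using lincomb_cong[of i a a "\<lambda>j. M' (i, j)" "M i" R] by (simp add: M M'_def)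
      qed
      show "\<forall>i<n. \<forall>v. lincomb R a v (Suc i) = \<zero> \<longrightarrow> int p dvd v i" by (rule a(4))
    qed (rule a(1))
    moreover have "H = carrier R" if H: "additive_subgroup H R" "\<forall>i<n - e. c i \<in> H"
      "\<forall>z\<in>carrier R. \<forall>k<s. z \<otimes> y k \<in> H" for H
    proof -
      \<comment> \<open>By minimality of \<open>J\<close>, containing all \<open>z y\<close> forces
        \<open>J\<close> into \<open>H\<close>; the \<open>c\<close> then supply everything modulo
        \<open>J\<close>.\<close>
      have "J \<subseteq> H" using min H by blast
      have "x \<in> H" if "x \<in> carrier R" for x
        using c(2)[OF that] additive_subgroup_lincomb[OF H(1), of "n - e" c] H(2) \<open>J \<subseteq> H\<close>
          additive_subgroup.a_closed[OF H(1)] by blast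
      then show ?thesis using additive_subgroup.a_subset[OF H(1)] by blast
    qed
    moreover have "c j \<otimes> c i =
          lincomb R (\<lambda>l. lincomb R a (\<lambda>m. B (l, m)) n) (\<lambda>l. U (j, i, l)) e \<oplus>
          lincomb R (\<lambda>l. lincomb R a (\<lambda>m. S (i, l, m)) n) (\<lambda>l. W (j, i, l)) s"
      if "i < n - e" "j < n - e" for i j
    proof -
      have "lincomb R (\<lambda>l. lincomb R a (\<lambda>m. B (l, m)) n) (\<lambda>l. U (j, i, l)) e = lincomb R b (u j i) e"
        using that by (intro lincomb_cong) (auto simp: eltB U_def)
      moreover have "lincomb R (\<lambda>l. lincomb R a (\<lambda>m. S (i, l, m)) n) (\<lambda>l. W (j, i, l)) s = lincomb R (d (c i)) (w j i) s"
        using that by (intro lincomb_cong) (auto simp: eltS W_def)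
      ultimately show ?thesis using uw(3) that by simp
    qed
    ultimately show ?thesis
      unfolding encodes.simps by (intro exI[of _ a] conjI) (auto simp: elt eltL eltQ eltC)
  qed
  ultimately show ?thesis using e(1) by blast
qed

section \<open>The upper bound\<close>

lemma card_digit_arrays: "finite I \<Longrightarrow> card (digit_arrays p I) = p ^ card I"
  by (simp add: card_PiE)

lemma card_ring_codes:
  "card (ring_codes p s n e) =
     p ^ (n * n + s * n + s * n * n + s * n * n + (n - e) * n + (n - e) * s * n + e * n
          + (n - e) * (n - e) * e + (n - e) * (n - e) * s)"
  by (simp add: ring_codes_def card_cartesian_product card_digit_arrays power_add mult.assoc)

lemma finite_ring_codes: "finite (ring_codes p s n e)"
  by (simp add: ring_codes_def finite_PiE)

text \<open>Choose a code of some member for each class; \<open>encodes_unique\<close> makes this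
  injective. As \<open>e\<close> depends on the ring, the codes are taken in a disjoint sum over
  \<open>e\<close>. Finiteness is stated too, since \<open>card\<close> is zero on infinite
  sets.\<close>

lemma nilpotent_rng_classes_le:
  assumes p: "prime p" and s: "n \<le> s * s" "s > 0"
  shows "finite (nilpotent_rng_classes (p ^ n))"
    "card (nilpotent_rng_classes (p ^ n)) \<le> (\<Sum>e\<le>n. card (ring_codes p s n e))"
proof -
  let ?X = "nilpotent_rng_classes (p ^ n)"
  have fin: "finite (Sigma {..n} (ring_codes p s n))" by (simp add: finite_ring_codes)
  have "\<exists>t\<in>Sigma {..n} (ring_codes p s n). \<exists>R\<in>X. encodes p s n (fst t) (snd t) R" if "X \<in> ?X" for X
  proof -
    from that obtain R where R: "R \<in> nilpotent_rngs (p ^ n)" "X = rng_iso_rel (p ^ n) `` {R}"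
      by (auto simp: nilpotent_rng_classes_def elim: quotientE)
    then have "R \<in> X" using equiv_class_self[OF equiv_rng_iso_rel] by blast
    moreover have "rng R" "card (carrier R) = p ^ n"
      using R(1) by (auto simp: nilpotent_rngs_def nilpotent_rng_def order_def)
    then obtain e c where "e \<le> n" "c \<in> ring_codes p s n e" "encodes p s n e c R"
      using code_exists p s by blast
    ultimately show ?thesis by (intro bexI[of _ "(e, c)"] bexI[of _ R]) auto
  qed
  then have "\<forall>X\<in>?X. \<exists>t. t \<in> Sigma {..n} (ring_codes p s n) \<and> (\<exists>R\<in>X. encodes p s n (fst t) (snd t) R)"
    by blast
  from bchoice[OF this] obtain t where t: "\<forall>X\<in>?X. t X \<in> Sigma {..n} (ring_codes p s n) \<and>
      (\<exists>R\<in>X. encodes p s n (fst (t X)) (snd (t X)) R)"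
    by (rule exE)
  have inj: "inj_on t ?X"
  proof (rule inj_onI)
    fix X X' assume X: "X \<in> ?X" "X' \<in> ?X" "t X = t X'"
    obtain R R' where R: "R \<in> X" "encodes p s n (fst (t X)) (snd (t X)) R"
      "R' \<in> X'" "encodes p s n (fst (t X)) (snd (t X)) R'"
      using t X by metis
    have "X \<subseteq> nilpotent_rngs (p ^ n)" "X' \<subseteq> nilpotent_rngs (p ^ n)"
      using X in_quotient_imp_subset[OF equiv_rng_iso_rel] by (auto simp: nilpotent_rng_classes_def)
    then have R': "R \<in> nilpotent_rngs (p ^ n)" "R' \<in> nilpotent_rngs (p ^ n)" using R by auto
    then have "rng_iso R R' \<noteq> {}"
      using encodes_unique[OF _ _ R(2,4)] by (simp add: nilpotent_rngs_def)
    then have "(R, R') \<in> rng_iso_rel (p ^ n)" using R' by (simp add: rng_iso_rel_def)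
    then show "X = X'"
      using quotient_eqI[OF equiv_rng_iso_rel _ _ R(1,3)] X by (simp add: nilpotent_rng_classes_def)
  qed
  have sub: "t ` ?X \<subseteq> Sigma {..n} (ring_codes p s n)" using t by blast
  show "finite ?X" using inj_on_finite[OF inj sub fin] .
  show "card ?X \<le> (\<Sum>e\<le>n. card (ring_codes p s n e))"
    using card_inj_on_le[OF inj sub fin] by (simp add: card_SigmaI finite_ring_codes)
qed

section \<open>The lower bound\<close>

definition bilin :: "nat \<Rightarrow> (nat \<times> nat \<times> nat \<Rightarrow> int) \<Rightarrow> (nat \<Rightarrow> int) \<Rightarrow> (nat \<Rightarrow> int) \<Rightarrow> nat \<Rightarrow> int" where
  "bilin r f v w i = (\<Sum>j<r. \<Sum>k<r. f (j, k, i) * (v j * w k))"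

text \<open>For \<open>r \<le> n\<close>, multiplication reads the coordinates below
  \<open>r\<close> and is zero there, so every product of three elements vanishes. Vectors over the
  prime field are represented by digits.\<close>

definition bilinear_rng :: "nat \<Rightarrow> nat \<Rightarrow> nat \<Rightarrow> (nat \<times> nat \<times> nat \<Rightarrow> int) \<Rightarrow> (nat \<Rightarrow> int) ring" where
  "bilinear_rng p n r f =
     \<lparr>carrier = {..<n} \<rightarrow>\<^sub>E {0..<int p},
      monoid.mult = (\<lambda>v w. \<lambda>i\<in>{..<n}. if i < r then 0 else bilin r f v w i mod int p),
      one = (\<lambda>_. 0),
      zero = (\<lambda>i\<in>{..<n}. 0),
      add = (\<lambda>v w. \<lambda>i\<in>{..<n}. (v i + w i) mod int p)\<rparr>"

text \<open>\<open>bilin\<close> is computed over the integers; this lets the reductions inside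
  \<open>add\<close> be dropped before bilinearity is used.\<close>

lemma bilin_cong_mod:
  assumes "\<And>j. j < r \<Longrightarrow> v j mod q = v' j mod q" "\<And>j. j < r \<Longrightarrow> w j mod q = w' j mod q"
  shows "bilin r f v w i mod q = bilin r f v' w' i mod q"
proof -
  have "q dvd f (j, k, i) * (v j * w k) - f (j, k, i) * (v' j * w' k)" if "j < r" "k < r" for j k
  proof -
    have "(f (j, k, i) * (v j * w k)) mod q = (f (j, k, i) * (v' j * w' k)) mod q"
      using assms that by (intro mod_mult_cong) auto
    then show ?thesis by (simp add: mod_eq_dvd_iff)
  qed
  then have "q dvd bilin r f v w i - bilin r f v' w' i"
    by (auto simp: bilin_def simp flip: sum_subtractf intro!: dvd_sum)
  then show ?thesis by (simp add: mod_eq_dvd_iff)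
qed

lemma bilin_add_left: "bilin r f (\<lambda>i. v i + v' i) w i = bilin r f v w i + bilin r f v' w i"
  and bilin_add_right: "bilin r f v (\<lambda>i. w i + w' i) i = bilin r f v w i + bilin r f v w' i"
  by (simp_all add: bilin_def algebra_simps sum.distrib)

lemma bilin_unit:
  assumes "j < r" "k < r"
  shows "bilin r f (\<lambda>i. if i = j then 1 else 0) (\<lambda>i. if i = k then 1 else 0) i = f (j, k, i)"
proof -
  have "bilin r f (\<lambda>i. if i = j then 1 else 0) (\<lambda>i. if i = k then 1 else 0) i =
        (\<Sum>j'<r. \<Sum>k'<r. if k' = k then (if j' = j then f (j', k', i) else 0) else 0)"
    unfolding bilin_def by (intro sum.cong refl) simp
  then show ?thesis using assms by simp
qed

context
  fixes p n r :: nat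
  assumes p: "p \<ge> 2" and r: "r \<le> n"
begin

private abbreviation "V \<equiv> {..<n} \<rightarrow>\<^sub>E {0..<int p}"
private abbreviation "Rf \<equiv> bilinear_rng p n r"

private lemma V_eqI: "v \<in> V \<Longrightarrow> w \<in> V \<Longrightarrow> (\<And>i. i < n \<Longrightarrow> v i = w i) \<Longrightarrow> v = w"
  by (rule PiE_ext) auto

private lemma V_mod: "v \<in> V \<Longrightarrow> i < n \<Longrightarrow> v i mod int p = v i"
  by (auto simp: PiE_iff)

lemma abelian_group_bilinear_rng: "abelian_group (Rf f)"
proof (rule abelian_groupI)
  fix x assume x: "x \<in> carrier (Rf f)"
  show "\<exists>y\<in>carrier (Rf f). y \<oplus>\<^bsub>Rf f\<^esub> x = \<zero>\<^bsub>Rf f\<^esub>"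
  proof (rule bexI)
    show "(\<lambda>i\<in>{..<n}. (- x i) mod int p) \<oplus>\<^bsub>Rf f\<^esub> x = \<zero>\<^bsub>Rf f\<^esub>"
      by (rule ext) (simp add: bilinear_rng_def mod_add_left_eq)
    show "(\<lambda>i\<in>{..<n}. (- x i) mod int p) \<in> carrier (Rf f)"
      using p by (simp add: bilinear_rng_def)
  qed
  show "\<zero>\<^bsub>Rf f\<^esub> \<oplus>\<^bsub>Rf f\<^esub> x = x"
  proof (rule V_eqI)
    show "\<zero>\<^bsub>Rf f\<^esub> \<oplus>\<^bsub>Rf f\<^esub> x \<in> V" using p by (simp add: bilinear_rng_def)
    show "x \<in> V" using x by (simp add: bilinear_rng_def)
    then show "(\<zero>\<^bsub>Rf f\<^esub> \<oplus>\<^bsub>Rf f\<^esub> x) i = x i" if "i < n" for i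
      using V_mod that by (simp add: bilinear_rng_def)
  qed
next
  fix x y assume "x \<in> carrier (Rf f)" "y \<in> carrier (Rf f)"
  show "x \<oplus>\<^bsub>Rf f\<^esub> y \<in> carrier (Rf f)" using p by (simp add: bilinear_rng_def)
  show "x \<oplus>\<^bsub>Rf f\<^esub> y = y \<oplus>\<^bsub>Rf f\<^esub> x" by (simp add: bilinear_rng_def add.commute)
next
  fix x y z
  show "(x \<oplus>\<^bsub>Rf f\<^esub> y) \<oplus>\<^bsub>Rf f\<^esub> z = x \<oplus>\<^bsub>Rf f\<^esub> (y \<oplus>\<^bsub>Rf f\<^esub> z)"
    by (rule ext) (simp add: bilinear_rng_def mod_add_left_eq mod_add_right_eq add.assoc)
next
  show "\<zero>\<^bsub>Rf f\<^esub> \<in> carrier (Rf f)" using p by (simp add: bilinear_rng_def)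
qed

lemma rng_bilinear_rng: "rng (Rf f)"
proof (intro rng.intro rng_axioms.intro abelian_group_bilinear_rng)
  fix x y z assume xyz: "x \<in> carrier (Rf f)" "y \<in> carrier (Rf f)" "z \<in> carrier (Rf f)"
  show "x \<otimes>\<^bsub>Rf f\<^esub> y \<in> carrier (Rf f)" using p by (auto simp: bilinear_rng_def)
  \<comment> \<open>Both sides vanish, because the inner product has zero coordinates below
    \<open>r\<close>.\<close>
  show "(x \<otimes>\<^bsub>Rf f\<^esub> y) \<otimes>\<^bsub>Rf f\<^esub> z = x \<otimes>\<^bsub>Rf f\<^esub> (y \<otimes>\<^bsub>Rf f\<^esub> z)"
    using r by (simp add: bilinear_rng_def fun_eq_iff bilin_def)
  have "bilin r f (\<lambda>i\<in>{..<n}. (x i + y i) mod int p) z i mod int p =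
      (bilin r f x z i mod int p + bilin r f y z i mod int p) mod int p" for i
  proof -
    have "bilin r f (\<lambda>i\<in>{..<n}. (x i + y i) mod int p) z i mod int p = bilin r f (\<lambda>i. x i + y i) z i mod int p"
      using r by (intro bilin_cong_mod) auto
    then show ?thesis by (simp add: bilin_add_left mod_add_eq)
  qed
  then show "(x \<oplus>\<^bsub>Rf f\<^esub> y) \<otimes>\<^bsub>Rf f\<^esub> z = x \<otimes>\<^bsub>Rf f\<^esub> z \<oplus>\<^bsub>Rf f\<^esub> y \<otimes>\<^bsub>Rf f\<^esub> z"
    by (simp add: bilinear_rng_def fun_eq_iff)
  have "bilin r f z (\<lambda>i\<in>{..<n}. (x i + y i) mod int p) i mod int p =
      (bilin r f z x i mod int p + bilin r f z y i mod int p) mod int p" for i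
  proof -
    have "bilin r f z (\<lambda>i\<in>{..<n}. (x i + y i) mod int p) i mod int p = bilin r f z (\<lambda>i. x i + y i) i mod int p"
      using r by (intro bilin_cong_mod) auto
    then show ?thesis by (simp add: bilin_add_right mod_add_eq)
  qed
  then show "z \<otimes>\<^bsub>Rf f\<^esub> (x \<oplus>\<^bsub>Rf f\<^esub> y) = z \<otimes>\<^bsub>Rf f\<^esub> x \<oplus>\<^bsub>Rf f\<^esub> z \<otimes>\<^bsub>Rf f\<^esub> y"
    by (simp add: bilinear_rng_def fun_eq_iff)
qed

lemma nilpotent_bilinear_rng: "nilpotent_rng (Rf f)"
proof -
  have "foldl (\<otimes>\<^bsub>Rf f\<^esub>) x xs = \<zero>\<^bsub>Rf f\<^esub>" if "length (x # xs) = 3" for x xs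
  proof -
    from that obtain y z where "xs = [y, z]"
      by (auto simp: numeral_3_eq_3 length_Suc_conv)
    then show ?thesis using r by (simp add: bilinear_rng_def fun_eq_iff bilin_def)
  qed
  then show ?thesis
    unfolding nilpotent_rng_def by (intro conjI rng_bilinear_rng exI[of _ 3]) auto
qed

lemma order_bilinear_rng: "order (Rf f) = p ^ n"
  by (simp add: order_def bilinear_rng_def card_PiE)

section \<open>Counting the tensors in one isomorphism class\<close>

private abbreviation "unit_vec j \<equiv> (\<lambda>i\<in>{..<n}. if i = j then 1 else 0 :: int)"

text \<open>Induction on the digit sum: a nonzero \<open>x\<close> is a unit vector plus some
  \<open>y\<close> of smaller digit sum. The two codomains share their addition.\<close>

lemma additive_isos_eqI:
  assumes h: "h \<in> rng_iso (Rf f0) (Rf f)" and h': "h' \<in> rng_iso (Rf f0) (Rf f')"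
    and eq: "\<And>i. i < n \<Longrightarrow> h (unit_vec i) = h' (unit_vec i)" and x: "x \<in> V"
  shows "h x = h' x"
  using x
proof (induction x rule: measure_induct_rule[of "\<lambda>x. nat (\<Sum>i<n. x i)"])
  case (less x)
  have V: "carrier (Rf f) = V" for f by (simp add: bilinear_rng_def)
  show ?case
  proof (cases "\<exists>i<n. x i \<noteq> 0")
    case False
    then have x0: "x = \<zero>\<^bsub>Rf f0\<^esub>"
      using less.prems p by (intro V_eqI) (auto simp: bilinear_rng_def)
    have "h \<zero>\<^bsub>Rf f0\<^esub> = \<zero>\<^bsub>Rf f\<^esub>" 
      by (rule additive_map_zero[OF abelian_group_bilinear_rng abelian_group_bilinear_rng])
        (use h in \<open>auto simp: rng_iso_def bij_betw_def\<close>)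
    moreover have "h' \<zero>\<^bsub>Rf f0\<^esub> = \<zero>\<^bsub>Rf f'\<^esub>" 
      by (rule additive_map_zero[OF abelian_group_bilinear_rng abelian_group_bilinear_rng])
        (use h' in \<open>auto simp: rng_iso_def bij_betw_def\<close>)
    moreover have "\<zero>\<^bsub>Rf f\<^esub> = \<zero>\<^bsub>Rf f'\<^esub>" by (simp add: bilinear_rng_def)
    ultimately show ?thesis using x0 by simp
  next
    case True
    then obtain i where i: "i < n" "x i \<noteq> 0" by blast
    have x: "0 \<le> x j \<and> x j < int p" if "j < n" for j
      using PiE_mem[OF less.prems, of j] that by simp
    then have xi: "x i \<ge> 1" "x i < int p" using i x[OF i(1)] by linarith+
    define y where "y = x(i := x i - 1)"
    have "0 \<le> x i - 1" "x i - 1 < int p" using xi by linarith+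
    then have y: "y \<in> V"
      using less.prems i by (auto simp: y_def PiE_iff extensional_def)
    have u: "unit_vec i \<in> V" using p by auto
    have add: "x = y \<oplus>\<^bsub>Rf f\<^esub> unit_vec i" for f
      using less.prems p by (intro V_eqI) (auto simp: bilinear_rng_def y_def V_mod)
    have "(\<Sum>j<n. x j) = x i + (\<Sum>j\<in>{..<n} - {i}. x j)" "(\<Sum>j<n. y j) = (x i - 1) + (\<Sum>j\<in>{..<n} - {i}. x j)"
      using i by (simp_all add: sum.remove[of _ i] y_def)
    moreover have "(\<Sum>j\<in>{..<n} - {i}. x j) \<ge> 0" using x by (intro sum_nonneg) auto
    ultimately have "nat (\<Sum>j<n. y j) < nat (\<Sum>j<n. x j)" using xi by simp
    then have "h y = h' y" using less.IH y by blast
    moreover have "h x = h y \<oplus>\<^bsub>Rf f\<^esub> h (unit_vec i)"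
      using h y u unfolding rng_iso_def V by (subst add[of f0]) blast
    moreover have "h' x = h' y \<oplus>\<^bsub>Rf f'\<^esub> h' (unit_vec i)"
      using h' y u unfolding rng_iso_def V by (subst add[of f0]) blast
    ultimately show ?thesis using eq[OF i(1)] by (simp add: bilinear_rng_def)
  qed
qed

text \<open>Both isomorphisms start from the same ring and agree on unit vectors, hence everywhere.
  As \<open>h\<close> is onto, the two codomains have the same multiplication, and products of unit
  vectors read off the tensor entries.\<close>

lemma tensor_eqI:
  assumes f: "f \<in> digit_arrays p ({..<r} \<times> {..<r} \<times> {r..<n})"
    and f': "f' \<in> digit_arrays p ({..<r} \<times> {..<r} \<times> {r..<n})"
    and h: "h \<in> rng_iso (Rf f0) (Rf f)" and h': "h' \<in> rng_iso (Rf f0) (Rf f')"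
    and eq: "\<And>i. i < n \<Longrightarrow> h (unit_vec i) = h' (unit_vec i)"
  shows "f = f'"
proof -
  have V: "carrier (Rf f) = V" for f by (simp add: bilinear_rng_def)
  have mult: "u \<otimes>\<^bsub>Rf f\<^esub> v = u \<otimes>\<^bsub>Rf f'\<^esub> v" if uv: "u \<in> V" "v \<in> V" for u v
  proof -
    have "V = h ` V" using h by (simp add: rng_iso_def V bij_betw_def)
    then have "u \<in> h ` V" "v \<in> h ` V" using uv by simp_all
    then obtain x y where xy: "x \<in> V" "y \<in> V" "u = h x" "v = h y" by (elim imageE)
    have "x \<otimes>\<^bsub>Rf f0\<^esub> y \<in> V"
      using rng.m_closed[OF rng_bilinear_rng, of x f0 y] xy by (simp add: V)
    then have "h (x \<otimes>\<^bsub>Rf f0\<^esub> y) = h' (x \<otimes>\<^bsub>Rf f0\<^esub> y)" using additive_isos_eqI[OF h h' eq] by blast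
    moreover have "h x = h' x" "h y = h' y" using additive_isos_eqI[OF h h' eq] xy by blast+
    moreover have "h (x \<otimes>\<^bsub>Rf f0\<^esub> y) = h x \<otimes>\<^bsub>Rf f\<^esub> h y" "h' (x \<otimes>\<^bsub>Rf f0\<^esub> y) = h' x \<otimes>\<^bsub>Rf f'\<^esub> h' y"
      using h h' xy unfolding rng_iso_def V by blast+
    ultimately show ?thesis using xy by simp
  qed
  show ?thesis
  proof (rule PiE_ext[OF f f'])
    fix t assume "t \<in> {..<r} \<times> {..<r} \<times> {r..<n}"
    then obtain j k i where t: "t = (j, k, i)" "j < r" "k < r" "r \<le> i" "i < n" by auto
    have eval: "(unit_vec j \<otimes>\<^bsub>Rf g\<^esub> unit_vec k) i = g (j, k, i)"
      if g: "g \<in> digit_arrays p ({..<r} \<times> {..<r} \<times> {r..<n})" for g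
    proof -
      have "bilin r g (unit_vec j) (unit_vec k) i mod int p =
            bilin r g (\<lambda>i. if i = j then 1 else 0) (\<lambda>i. if i = k then 1 else 0) i mod int p"
        using r by (intro bilin_cong_mod) auto
      also have "\<dots> = g (j, k, i)" using PiE_mem[OF g, of "(j, k, i)"] t by (simp add: bilin_unit)
      finally show ?thesis using t by (simp add: bilinear_rng_def)
    qed
    have "unit_vec j \<in> V" "unit_vec k \<in> V" using p by auto
    then show "f t = f' t" using mult[of "unit_vec j" "unit_vec k"] eval[OF f] eval[OF f'] t(1) by metis
  qed
qed

text \<open>Send a tensor to its class together with the images of the \<open>n\<close> unit vectors
  under an isomorphism from a fixed member of the class. By \<open>tensor_eqI\<close> this is
  injective, and there are \<open>p ^ (n * n)\<close> tuples of images.\<close>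

lemma nilpotent_rng_classes_ge:
  assumes fin: "finite (nilpotent_rng_classes (p ^ n))"
  shows "p ^ (r * r * (n - r)) \<le> card (nilpotent_rng_classes (p ^ n)) * p ^ (n * n)"
proof -
  let ?F = "digit_arrays p ({..<r} \<times> {..<r} \<times> {r..<n})"
  let ?X = "nilpotent_rng_classes (p ^ n)"
  let ?T = "{..<n} \<rightarrow>\<^sub>E V"
  have V: "carrier (Rf f) = V" for f by (simp add: bilinear_rng_def)
  have "\<exists>S\<in>nilpotent_rngs (p ^ n). rng_iso (Rf f) S \<noteq> {}" for f
    by (rule nilpotent_rng_copy_on_nat[OF nilpotent_bilinear_rng order_bilinear_rng]) (use p in simp)
  then have "\<forall>f. \<exists>S. S \<in> nilpotent_rngs (p ^ n) \<and> rng_iso (Rf f) S \<noteq> {}" by blast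
  from choice[OF this] obtain S where S: "\<And>f. S f \<in> nilpotent_rngs (p ^ n)" "\<And>f. rng_iso (Rf f) (S f) \<noteq> {}"
    by blast
  define cl where "cl f = rng_iso_rel (p ^ n) `` {S f}" for f
  have cl: "cl f \<in> ?X" for f
    using S(1) by (auto simp: cl_def nilpotent_rng_classes_def intro: quotientI)
  \<comment> \<open>The fixed member is given by a tensor again, so that all isomorphisms run
    between rings with carrier \<open>V\<close>.\<close>
  define rep where "rep X = (SOME f. cl f = X)" for X
  have rep: "cl (rep (cl f)) = cl f" for f
    unfolding rep_def by (rule someI[of _ f]) simp
  \<comment> \<open>Classes consist of rings on \<open>nat\<close>, so the isomorphism passes
    through the copies: from \<open>Rf ?g\<close> to \<open>S ?g\<close>, on to \<open>S f\<close>,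
    and back to \<open>Rf f\<close>.\<close>
  have iso: "rng_iso (Rf (rep (cl f))) (Rf f) \<noteq> {}" for f
  proof -
    let ?g = "rep (cl f)"
    have "(S ?g, S f) \<in> rng_iso_rel (p ^ n)"
      using eq_equiv_class[OF rep[of f, unfolded cl_def] equiv_rng_iso_rel S(1)] by (simp add: cl_def)
    then obtain h where h: "h \<in> rng_iso (S ?g) (S f)" by (auto simp: rng_iso_rel_def)
    obtain h1 where h1: "h1 \<in> rng_iso (Rf ?g) (S ?g)" using S(2) by blast
    obtain h2 where h2: "h2 \<in> rng_iso (Rf f) (S f)" using S(2) by blast
    have "inv_into (carrier (Rf f)) h2 \<in> rng_iso (S f) (Rf f)"
      by (rule rng_iso_sym[OF rng_bilinear_rng h2])
    from rng_iso_trans[OF rng_iso_trans[OF h1 h] this] show ?thesis by blast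
  qed
  then have "\<forall>f. \<exists>h. h \<in> rng_iso (Rf (rep (cl f))) (Rf f)" by blast
  from choice[OF this] obtain h where h: "\<And>f. h f \<in> rng_iso (Rf (rep (cl f))) (Rf f)" by blast
  define enc where "enc f = (cl f, \<lambda>i\<in>{..<n}. h f (unit_vec i))" for f
  have "inj_on enc ?F"
  proof (rule inj_onI)
    fix f f' assume f: "f \<in> ?F" "f' \<in> ?F" "enc f = enc f'"
    then have "cl f = cl f'" by (simp add: enc_def)
    moreover have "h f (unit_vec i) = h f' (unit_vec i)" if "i < n" for i
      using f(3) that unfolding enc_def by (metis (no_types, lifting) lessThan_iff prod.inject restrict_apply')
    ultimately show "f = f'"
      using tensor_eqI[OF f(1,2) h[of f], of "h f'"] h[of f'] by simp
  qed
  moreover have "enc ` ?F \<subseteq> ?X \<times> ?T"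
  proof -
    have "h f (unit_vec i) \<in> V" for f i
    proof -
      have "h f ` V = V" using h[of f] by (simp add: rng_iso_def V bij_betw_def)
      moreover have "unit_vec i \<in> V" using p by auto
      ultimately show ?thesis by blast
    qed
    then have "(\<lambda>i\<in>{..<n}. h f (unit_vec i)) \<in> ?T" for f
      by (simp add: restrict_PiE_iff)
    then show ?thesis using cl by (intro image_subsetI) (simp only: enc_def mem_Sigma_iff simp_thms)
  qed
  moreover have "finite (?X \<times> ?T)" using fin by (auto intro!: finite_PiE)
  ultimately have "card ?F \<le> card (?X \<times> ?T)" by (rule card_inj_on_le)
  moreover have "card ?F = p ^ (r * r * (n - r))" by (simp add: card_PiE mult.assoc)
  moreover have "card (?X \<times> ?T) = card ?X * p ^ (n * n)"
    by (simp add: card_cartesian_product card_PiE power_mult)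
  ultimately show ?thesis by simp
qed

end

section \<open>The asymptotic estimate\<close>

text \<open>The maximum is at \<open>y = x / 3\<close>, so the difference has the double factor
  \<open>(x - 3 * y) ^ 2\<close>; the cofactor \<open>4 * x - 3 * y\<close> is nonnegative on the
  given range.\<close>

lemma cubic_max:
  fixes x y :: real
  assumes "0 \<le> y" "y \<le> x"
  shows "(x - y) ^ 2 * y \<le> 4 / 27 * x ^ 3"
proof -
  have "4 * x ^ 3 - 27 * ((x - y) ^ 2 * y) = (x - 3 * y) ^ 2 * (4 * x - 3 * y)"
    by (simp add: power2_eq_square power3_eq_cube algebra_simps)
  moreover have "\<dots> \<ge> 0" using assms by (intro mult_nonneg_nonneg) auto
  ultimately show ?thesis by linarith
qed

text \<open>Apart from \<open>(n - e) * (n - e) * e\<close> there are nine terms, each at most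
  \<open>s * n * n\<close>; with \<open>s\<close> at most \<open>2 * sqrt n\<close> this gives the
  constant \<open>9 * 2 = 18\<close>. The leading \<open>n\<close> pays for the sum over the
  \<open>n + 1\<close> values of \<open>e\<close>.\<close>

lemma code_length_le:
  fixes n s e :: nat
  assumes n: "n \<ge> 1" and e: "e \<le> n" and s: "s \<ge> 1" "real s \<le> 2 * sqrt (real n)"
  shows "real (n + (n * n + s * n + s * n * n + s * n * n + (n - e) * n + (n - e) * s * n + e * n
          + (n - e) * (n - e) * e + (n - e) * (n - e) * s))
     \<le> 4 / 27 * real n ^ 3 + 18 * real n powr (5 / 2)"
proof -
  define t where "t = (n - e) * (n - e) * e"
  have n2: "n \<le> s * n * n" "n * n \<le> s * n * n" "s * n \<le> s * n * n"
    using n s by (auto simp: mult.assoc)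
  have e2: "(n - e) * n \<le> n * n" "(n - e) * s * n \<le> s * n * n" "e * n \<le> n * n" "(n - e) * (n - e) * s \<le> s * n * n"
    using e by (auto simp: mult.assoc mult.commute mult.left_commute intro!: mult_le_mono)
  have "n + (n * n + s * n + s * n * n + s * n * n + (n - e) * n + (n - e) * s * n + e * n + t
          + (n - e) * (n - e) * s) \<le> t + 9 * (s * n * n)"
    using n2 e2 by linarith
  then have "real (n + (n * n + s * n + s * n * n + s * n * n + (n - e) * n + (n - e) * s * n + e * n + t
          + (n - e) * (n - e) * s)) \<le> real t + 9 * (real s * real n * real n)"
    by (metis of_nat_add of_nat_le_iff of_nat_mult of_nat_numeral)
  also have "real t = (real n - real e) ^ 2 * real e"
    using e by (simp add: t_def of_nat_diff power2_eq_square)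
  also have "\<dots> \<le> 4 / 27 * real n ^ 3" using e by (intro cubic_max) auto
  also have "real s * real n * real n \<le> 2 * sqrt (real n) * real n * real n"
    using s by (intro mult_right_mono) auto
  also have "\<dots> = 2 * real n powr (5 / 2)"
  proof -
    have "real n powr (5 / 2) = real n powr (1 / 2 + 2)" by simp
    also have "\<dots> = real n powr (1 / 2) * real n powr 2" by (rule powr_add)
    also have "\<dots> = sqrt (real n) * (real n * real n)"
      using n by (simp add: powr_half_sqrt power2_eq_square)
    finally show ?thesis by simp
  qed
  finally show ?thesis by (simp add: t_def)
qed

text \<open>\<open>r^2 (n - r)\<close> is largest near \<open>r = 2n/3\<close>. With
  \<open>m = n div 3\<close> it is at least \<open>4 m^3\<close>, and \<open>3 m \<ge> n - 2\<close>
  costs only a quadratic term.\<close>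

lemma bilinear_dim_ge:
  fixes n :: nat
  defines "r \<equiv> 2 * (n div 3)"
  assumes n: "n \<ge> 1"
  shows "4 / 27 * real n ^ 3 - real n ^ 2 \<le> real (r * r * (n - r))"
proof -
  define m where "m = n div 3"
  have m: "3 * m \<le> n" "n \<le> 3 * m + 2" unfolding m_def by linarith+
  \<comment> \<open>The odd exponent keeps this monotone for \<open>n = 1\<close>, where the base is
    negative.\<close>
  have "(real n - 2) ^ 3 \<le> (3 * real m) ^ 3"
    using m by (intro power_mono_odd) auto
  then have "4 / 27 * (real n - 2) ^ 3 \<le> 4 * real m ^ 3" by (simp add: power_mult_distrib)
  moreover have "4 * real m ^ 3 \<le> real (r * r * (n - r))"
  proof -
    have "4 * (m * m) * m \<le> 4 * (m * m) * (n - r)"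
      using m by (intro mult_le_mono2) (simp add: r_def m_def)
    also have "\<dots> = r * r * (n - r)" by (simp add: r_def m_def)
    finally have "real (4 * (m * m) * m) \<le> real (r * r * (n - r))" by (simp only: of_nat_le_iff)
    then show ?thesis by (simp add: power3_eq_cube mult.assoc)
  qed
  moreover have "(real n - 2) ^ 3 = real n ^ 3 - 6 * real n ^ 2 + (12 * real n - 8)"
    by (simp add: power2_eq_square power3_eq_cube algebra_simps)
  moreover have "real n \<ge> 1" "real n ^ 2 \<ge> 0" using n by simp_all
  ultimately show ?thesis by linarith
qed

theorem theorem2p3:
  fixes p :: nat
  assumes "prime p"
  shows "\<exists>\<alpha> :: nat \<Rightarrow> real.
           (\<forall>n\<ge>1. real (card (nilpotent_rng_classes (p ^ n))) = real p powr \<alpha> n) \<and>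
           (\<exists>C :: real. \<forall>n\<ge>1.
              \<bar>\<alpha> n - 4 / 27 * real n ^ 3\<bar> \<le> C * real n powr (5 / 2))"
proof -
  have p: "p \<ge> 2" using assms by (rule prime_ge_2_nat)
  define N where "N n = card (nilpotent_rng_classes (p ^ n))" for n
  have bounds: "0 < N n"
      "4 / 27 * real n ^ 3 - 18 * real n powr (5 / 2) \<le> log p (N n)"
      "log p (N n) \<le> 4 / 27 * real n ^ 3 + 18 * real n powr (5 / 2)"
    if n: "n \<ge> 1" for n
  proof -
    \<comment> \<open>This choice meets both demands: \<open>n \<le> s * s\<close> for the greedy
      cover, and \<open>s\<close> at most \<open>2 * sqrt n\<close> for the error term.\<close>
    define s where "s = nat \<lceil>sqrt (real n)\<rceil>"
    have sqrt1: "1 \<le> sqrt (real n)" using n by simp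
    have s: "sqrt (real n) \<le> real s" "real s \<le> sqrt (real n) + 1"
      using sqrt1 unfolding s_def by linarith+
    have "s \<ge> 1" using s sqrt1 by linarith
    have "sqrt (real n) * sqrt (real n) \<le> real s * real s"
      using s sqrt1 by (intro mult_mono) auto
    then have "real n \<le> real (s * s)" by simp
    then have ns: "n \<le> s * s" by (simp only: of_nat_le_iff)
    have s2: "real s \<le> 2 * sqrt (real n)" using s sqrt1 by linarith
    note upper = nilpotent_rng_classes_le[OF assms ns]
    define r where "r = 2 * (n div 3)"
    have "r \<le> n" unfolding r_def by linarith
    have lower: "p ^ (r * r * (n - r)) \<le> N n * p ^ (n * n)"
      unfolding N_def using nilpotent_rng_classes_ge[OF p \<open>r \<le> n\<close>] upper(1) \<open>s \<ge> 1\<close> by simp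
    show N0: "0 < N n"
    proof (rule ccontr)
      assume "\<not> 0 < N n"
      then show False using lower p by simp
    qed
    have n2: "real n ^ 2 \<le> real n powr (5 / 2)"
    proof -
      have "real n powr 2 \<le> real n powr (5 / 2)" using n by (intro powr_mono) auto
      then show ?thesis using n by simp
    qed
    have "real p ^ (r * r * (n - r)) \<le> real (N n) * real p ^ (n * n)"
      using lower by (metis of_nat_le_iff of_nat_mult of_nat_power)
    then have "log p (real p ^ (r * r * (n - r))) \<le> log p (real (N n) * real p ^ (n * n))"
      using p N0 by (subst log_le_cancel_iff) auto
    \<comment> \<open>The images of the unit vectors cost \<open>n^2\<close> and the rounding of
      \<open>r\<close> at most another \<open>n^2\<close>; both fit into the error since
      \<open>n^2 \<le> n^(5/2)\<close>.\<close>
    then have "real (r * r * (n - r)) \<le> log p (N n) + real (n * n)"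
      using p N0 by (simp add: log_mult log_nat_power)
    moreover have "real (n * n) = real n ^ 2" by (simp add: power2_eq_square)
    moreover have "real n powr (5 / 2) \<ge> 0" by simp
    ultimately show "4 / 27 * real n ^ 3 - 18 * real n powr (5 / 2) \<le> log p (N n)"
      using bilinear_dim_ge[OF n, folded r_def] n2 by linarith
    define b where "b = 4 / 27 * real n ^ 3 + 18 * real n powr (5 / 2)"
    \<comment> \<open>Subtracting \<open>n\<close> in the exponent leaves a factor
      \<open>p^n\<close>, which absorbs the \<open>n + 1\<close> summands of the sum over
      \<open>e\<close>.\<close>
    have code: "real (card (ring_codes p s n e)) \<le> real p powr (b - real n)" if "e \<le> n" for e
    proof -
      let ?l = "n * n + s * n + s * n * n + s * n * n + (n - e) * n + (n - e) * s * n + e * n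
          + (n - e) * (n - e) * e + (n - e) * (n - e) * s"
      have "real (n + ?l) \<le> b"
        unfolding b_def by (rule code_length_le[OF n that \<open>s \<ge> 1\<close> s2])
      then have "real p powr real ?l \<le> real p powr (b - real n)"
        using p by (intro powr_mono) auto
      moreover have "real (card (ring_codes p s n e)) = real p powr real ?l"
        using p by (subst powr_realpow) (auto simp: card_ring_codes)
      ultimately show ?thesis by simp
    qed
    have "N n \<le> (\<Sum>e\<le>n. card (ring_codes p s n e))"
      using upper(2) \<open>s \<ge> 1\<close> by (simp add: N_def)
    then have "real (N n) \<le> (\<Sum>e\<le>n. real (card (ring_codes p s n e)))"
      by (simp only: of_nat_le_iff flip: of_nat_sum)
    also have "\<dots> \<le> (\<Sum>e\<le>n. real p powr (b - real n))"
      using code by (intro sum_mono) auto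
    also have "\<dots> = real (Suc n) * real p powr (b - real n)" by simp
    also have "\<dots> \<le> real p powr real n * real p powr (b - real n)"
    proof (rule mult_right_mono)
      have "Suc n \<le> 2 ^ n" by (induction n) auto
      also have "\<dots> \<le> p ^ n" using p by (intro power_mono) auto
      finally have "real (Suc n) \<le> real (p ^ n)" by (simp only: of_nat_le_iff)
      then show "real (Suc n) \<le> real p powr real n" using p by (simp add: powr_realpow)
    qed simp
    also have "\<dots> = real p powr b" by (simp flip: powr_add)
    finally have "log p (N n) \<le> log p (real p powr b)"
      using p N0 by (subst log_le_cancel_iff) auto
    then show "log p (N n) \<le> 4 / 27 * real n ^ 3 + 18 * real n powr (5 / 2)"
      using p by (simp add: b_def)
  qed
  show ?thesis
  proof (intro exI[of _ "\<lambda>n. log p (N n)"] conjI exI[of _ 18] allI impI)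
    fix n :: nat assume n: "n \<ge> 1"
    show "real (card (nilpotent_rng_classes (p ^ n))) = real p powr log p (N n)"
      using p bounds(1)[OF n] by (simp add: N_def)
    show "\<bar>log p (N n) - 4 / 27 * real n ^ 3\<bar> \<le> 18 * real n powr (5 / 2)"
      using bounds(2,3)[OF n] by linarith
  qed
qed

end
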